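(* In the Gaussian linear model $Y=X\beta^\star+\xi$, $\xi\sim\mathcal N_n(0,\Sigma)$ with known $\Sigma$, assume that $R=X^\top\Sigma X=\mathrm{Id}_p$. Then under any alternative in $\mathbb H_1$ (that is, for every $\beta^\star\notin\ker(X)$), the probability density function of $S$ on $(0,1)$ is decreasing. Hence, for every significance level $\alpha\in(0,1)$, the region $\{S\le\alpha\}$ is the most powerful region among all possible regions: for every Borel set $A\subset[0,1]$ such that $\mathbb P\{S\in A\}\le\alpha$ under $\mathbb H_0$, one has under any alternative in $\mathbb H_1$ $$\mathbb P\{S\in A\}\ \le\ \mathbb P\{S\le\alpha\}.$$
   Context: Let $n\ge1$, $p\ge2$, let $X\in\mathbb R^{n\times p}$ be a design matrix, let $\Sigma\in\mathbb R^{n\times n}$ be a (known) variance-covariance matrix (symmetric positive semidefinite), let $\beta^\star\in\mathbb R^p$, and observe $Y=X\beta^\star+\xi$ with $\xi\sim\mathcal N_n(0,\Sigma)$. Put $U:=X^\top Y\sim\mathcal N_p(\mu^\star,R)$ with $\mu^\star:=X^\top X\beta^\star$ and $R:=X^\top\Sigma X$. The hypotheses are $\mathbb H_0:\ \beta^\star\in\ker(X)$ (equivalently $\mu^\star=0$) against $\mathbb H_1:\ \beta^\star\notin\ker(X)$ (equivalently $\mu^\star\ne0$). Almost surely there is a unique pair $(\hat\imath,\hat\varepsilon)\in\{1,\dots,p\}\times\{\pm1\}$ with $\hat\varepsilon U_{\hat\imath}=\|U\|_\infty$. Set $\lambda_1:=\hat\varepsilon U_{\hat\imath}$ and $$\lambda_2:=\max_{1\le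 j\le p,\ j\neq\hat\imath}\ \max\Big\{\frac{U_j-R_{j\hat\imath}U_{\hat\imath}}{1-\hat\varepsilon R_{j\hat\imath}},\ \frac{-U_j+R_{j\hat\imath}U_{\hat\imath}}{1+\hat\varepsilon R_{j\hat\imath}}\Big\}$$ (so that for $R=\mathrm{Id}_p$, $\lambda_2=\max_{j\ne\hat\imath}|U_j|$). Let $\Phi$ be the standard normal cumulative distribution function and $\bar\Phi:=1-\Phi$. The test statistic is $S:=\bar\Phi(\lambda_1)/\bar\Phi(\lambda_2)$. *)

theory Defs
  imports "HOL-Probability.Probability"
begin

definition pos_semidef :: "real^'n^'n \<Rightarrow> bool" where
  "pos_semidef A \<longleftrightarrow> transpose A = A \<and> (\<forall>v. 0 \<le> v \<bullet> (A *v v))"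

text \<open>
  The normal law with mean \<open>m\<close> and variance \<open>v\<close>. Zero variance gives the point mass at \<open>m\<close>;
  this case occurs below because covariance matrices may be singular.
\<close>

definition normal_law :: "real \<Rightarrow> real \<Rightarrow> real measure" where
  "normal_law m v =
     (if v = 0 then return borel m
      else density lborel (\<lambda>x. ennreal (normal_density m (sqrt v) x)))"

text \<open>
  \<open>\<xi>\<close> is a Gaussian vector with mean \<open>m\<close> and covariance \<open>C\<close>: each linear form
  \<open>a \<bullet> \<xi>\<close> is normal with mean \<open>a \<bullet> m\<close> and variance \<open>a\<^sup>T C a\<close>.
\<close>

definition gaussian_vector ::
    "'a measure \<Rightarrow> ('a \<Rightarrow> real^'n) \<Rightarrow> real^'n \<Rightarrow> real^'n^'n \<Rightarrow> bool" where
  "gaussian_vector M \<xi> m C \<longleftrightarrow>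
     \<xi> \<in> borel_measurable M \<and>
     (\<forall>a. distr M borel (\<lambda>\<omega>. a \<bullet> \<xi> \<omega>) = normal_law (a \<bullet> m) (a \<bullet> (C *v a)))"

definition std_normal_tail :: "real \<Rightarrow> real" where
  "std_normal_tail x = 1 - cdf std_normal_distribution x"

text \<open>
  In the next three definitions \<open>U\<close> stands for \<open>X\<^sup>T Y\<close> and \<open>R\<close> for its covariance matrix.
  The maximizing index and sign are almost surely unique; on the remaining null set an arbitrary
  maximizing pair is chosen.
\<close>

definition max_pair :: "real^'p \<Rightarrow> 'p \<times> real" where
  "max_pair U = (SOME (i, \<epsilon>). \<epsilon> \<in> {1, -1} \<and> \<epsilon> * U $ i = infnorm U)"

definition lambda1 :: "real^'p \<Rightarrow> real" where
  "lambda1 U = (case max_pair U of (i, \<epsilon>) \<Rightarrow> \<epsilon> * U $ i)"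

definition lambda2 :: "real^'p^'p \<Rightarrow> real^'p \<Rightarrow> real" where
  "lambda2 R U =
     (case max_pair U of (i, \<epsilon>) \<Rightarrow>
        (MAX j \<in> UNIV - {i}.
           max ((U $ j - R $ j $ i * U $ i) / (1 - \<epsilon> * R $ j $ i))
               ((- U $ j + R $ j $ i * U $ i) / (1 + \<epsilon> * R $ j $ i))))"

definition score_cov :: "real^'p^'n \<Rightarrow> real^'n^'n \<Rightarrow> real^'p^'p" where
  "score_cov X \<Sigma> = transpose X ** \<Sigma> ** X"

definition spacing_stat :: "real^'p^'n \<Rightarrow> real^'n^'n \<Rightarrow> real^'n \<Rightarrow> real" where
  "spacing_stat X \<Sigma> y =
     (let U = transpose X *v y; R = score_cov X \<Sigma>
      in std_normal_tail (lambda1 U) / std_normal_tail (lambda2 R U))"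

end

theory Submission
  imports Defs
begin

text \<open>
  Put \<open>U = X\<^sup>T Y\<close>, a Gaussian vector with identity covariance and mean \<open>\<mu> = X\<^sup>T X \<beta>\<close>, and pass to the
  values \<open>T\<^sub>j\<close>, the standard normal tail probabilities at \<open>\<bar>U\<^sub>j\<bar>\<close>. The tail function is strictly
  decreasing, so the largest modulus becomes the smallest \<open>T\<^sub>j\<close>, the second largest becomes the second
  smallest, and \<open>S\<close> is the ratio of the two (\<open>spacing_ratio_eq_min_ratio\<close>). In this form the
  arbitrary choice of the maximizing pair is irrelevant, since the second smallest value does not
  depend on how a tie for the first place is broken.

  The point of the change of variables is that it turns the null law into Lebesgue measure: if
  \<open>\<mu>\<^sub>j = 0\<close>, then \<open>T\<^sub>j\<close> is uniform on an interval \<open>(0, \<tau>)\<close>, where \<open>\<tau>\<close> is the tail at \<open>0\<close>. In general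
  its density on that interval is \<open>2 exp (-\<mu>\<^sub>j\<^sup>2/2) cosh (\<mu>\<^sub>j q(t))\<close>, with \<open>q\<close> the inverse of the tail
  (\<open>distr_folded_tail\<close>). Since \<open>q\<close> is positive and decreasing, this density is decreasing, strictly
  so when \<open>\<mu>\<^sub>j \<noteq> 0\<close>.

  Let \<open>m\<^sub>i\<close> be the minimum of the \<open>T\<^sub>j\<close> with \<open>j \<noteq> i\<close>. Up to a null set the events \<open>T\<^sub>i < m\<^sub>i\<close>
  partition the space, on each of them \<open>S = T\<^sub>i / m\<^sub>i\<close>, and \<open>T\<^sub>i\<close> is independent of \<open>m\<^sub>i\<close>. With \<open>k\<^sub>i\<close> the
  density of \<open>T\<^sub>i\<close>, a change of scale gives the density of \<open>S\<close> on \<open>(0,1)\<close> as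
  \<open>s \<mapsto> \<Sum>\<^sub>i E[m\<^sub>i k\<^sub>i(s m\<^sub>i)]\<close> (\<open>distr_min_ratio\<close>). Every term inherits the monotonicity of \<open>k\<^sub>i\<close>, and one
  of them is strictly decreasing if \<open>\<mu> \<noteq> 0\<close>. If \<open>\<mu> = 0\<close>, all \<open>k\<^sub>i\<close> are constant on \<open>(0, \<tau>)\<close> and \<open>S\<close> is
  uniform on \<open>(0,1)\<close>. A region of level \<open>\<alpha>\<close> is then a set of Lebesgue measure at most \<open>\<alpha>\<close>, and among
  those a decreasing density gives most mass to \<open>(0, \<alpha>]\<close> (\<open>decreasing_density_initial_interval\<close>).

  The hypothesis on \<open>\<xi>\<close> speaks only about the laws of linear forms. The independence of the
  components of \<open>U\<close> has to be recovered from it, which is Kac's theorem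
  (\<open>indep_vars_if_char_factorizes\<close>).
\<close>

section \<open>Independence from factorizing characteristic functions\<close>

text \<open>
  A weight of either sign is reduced to a change of probability: \<open>2 + \<phi>\<close> is positive, and once
  normalized it is the density of a probability under which \<open>V\<close> has the same characteristic function
  as before, hence by Levy's uniqueness theorem the same law.
\<close>

lemma (in prob_space) weighted_char_uniqueness_real:
  fixes V \<phi> :: "'a \<Rightarrow> real" and c :: real
  assumes V [measurable]: "V \<in> borel_measurable M" and phi [measurable]: "\<phi> \<in> borel_measurable M"
    and bnd: "\<And>\<omega>. \<bar>\<phi> \<omega>\<bar> \<le> 1"
    and eq: "\<And>s. (CLINT \<omega>|M. complex_of_real (\<phi> \<omega>) * iexp (s * V \<omega>)) = of_real c * char (distr M borel V) s"
    and A [measurable]: "A \<in> sets borel"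
  shows "(\<integral>\<omega>. \<phi> \<omega> * indicator A (V \<omega>) \<partial>M) = c * \<P>(\<omega> in M. V \<omega> \<in> A)"
proof -
  have intphi: "integrable M \<phi>"
    using bnd by (intro integrable_const_bound[of _ 1]) auto
  have ch: "char (distr M borel V) s = (CLINT \<omega>|M. iexp (s * V \<omega>))" for s
    by (simp add: char_def integral_distr)
  have c: "(\<integral>\<omega>. \<phi> \<omega> \<partial>M) = c"
    using eq[of 0] by (simp add: ch prob_space)
  have "\<bar>\<integral>\<omega>. \<phi> \<omega> \<partial>M\<bar> \<le> (\<integral>\<omega>. 1 \<partial>M)"
    using bnd by (intro order.trans[OF integral_abs_bound] integral_mono) (use intphi in \<open>auto\<close>)
  then have c1: "\<bar>c\<bar> \<le> 1" by (simp add: c prob_space)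
  then have c2: "2 + c > 0" by linarith
  define w where "w \<omega> = (2 + \<phi> \<omega>) / (2 + c)" for \<omega>
  have w0: "0 \<le> w \<omega>" for \<omega> using bnd[of \<omega>] c2 by (auto simp: w_def intro!: divide_nonneg_pos)
  have w [measurable]: "w \<in> borel_measurable M" by (simp add: w_def[abs_def])
  have intw: "integrable M w" using intphi by (simp add: w_def[abs_def])
  define N where "N = density M (\<lambda>\<omega>. ennreal (w \<omega>))"
  have sN [measurable_cong, simp]: "sets N = sets M" and spN [simp]: "space N = space M" by (auto simp: N_def)
  have "(\<integral>\<omega>. w \<omega> \<partial>M) = 1"
    using intphi c2 by (simp add: w_def c prob_space)
  then have "emeasure N (space N) = 1"
    using intw w0 by (simp add: N_def emeasure_density nn_integral_eq_integral[symmetric] cong: nn_integral_cong)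
       (simp add: nn_integral_eq_integral)
  then interpret N: prob_space N by (rule prob_spaceI)
  have int_e: "integrable M (\<lambda>\<omega>. iexp (s * V \<omega>))" for s
    by (intro integrable_const_bound[of _ 1]) auto
  have int_pe: "integrable M (\<lambda>\<omega>. of_real (\<phi> \<omega>) * iexp (s * V \<omega>))" for s
    using bnd by (intro integrable_const_bound[of _ 1]) (auto simp: norm_mult)
  have "char (distr N borel V) s = char (distr M borel V) s" for s
  proof -
    have "char (distr N borel V) s = (CLINT \<omega>|N. iexp (s * V \<omega>))"
      by (simp add: char_def integral_distr)
    also have "\<dots> = (CLINT \<omega>|M. w \<omega> *\<^sub>R iexp (s * V \<omega>))"
      unfolding N_def using w0 by (intro integral_density) auto
    also have "\<dots> = (CLINT \<omega>|M. (2 * iexp (s * V \<omega>) + of_real (\<phi> \<omega>) * iexp (s * V \<omega>)) / of_real (2 + c))"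
      by (intro Bochner_Integration.integral_cong) (auto simp: w_def scaleR_conv_of_real algebra_simps)
    also have "\<dots> = (2 * char (distr M borel V) s + of_real c * char (distr M borel V) s) / of_real (2 + c)"
      using int_e int_pe by (simp add: eq ch[symmetric] del: of_real_mult of_real_add)
    also have "\<dots> = char (distr M borel V) s"
    proof -
      have "complex_of_real (2 + c) \<noteq> 0" using c2 by (metis less_irrefl of_real_eq_0_iff)
      then show ?thesis by (simp add: field_simps)
    qed
    finally show ?thesis .
  qed
  then have "distr N borel V = distr M borel V"
    by (intro Levy_uniqueness ext)
      (auto intro!: real_distribution.intro real_distribution_axioms.intro N.prob_space_distr prob_space_distr)
  then have "measure (distr N borel V) A = measure (distr M borel V) A" by simp
  moreover have "measure (distr N borel V) A = (\<integral>\<omega>. indicator A (V \<omega>) \<partial>N)"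
  proof -
    have "(\<integral>\<omega>. indicator A (V \<omega>) \<partial>N) = (\<integral>x. indicator A x \<partial>distr N borel V :: real)"
      by (subst integral_distr) auto
    then show ?thesis by simp
  qed
  moreover have "(\<integral>\<omega>. indicator A (V \<omega>) \<partial>N) = (\<integral>\<omega>. w \<omega> * indicator A (V \<omega>) \<partial>M)"
    unfolding N_def using w0 by (subst integral_density) auto
  moreover have "(\<integral>\<omega>. w \<omega> * indicator A (V \<omega>) \<partial>M)
     = (2 * (\<integral>\<omega>. indicator A (V \<omega>) \<partial>M) + (\<integral>\<omega>. \<phi> \<omega> * indicator A (V \<omega>) \<partial>M)) / (2 + c)"
  proof -
    have i1: "integrable M (\<lambda>\<omega>. indicator A (V \<omega>) :: real)"
      by (intro integrable_const_bound[of _ 1]) (auto simp: indicator_def)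
    have i2: "integrable M (\<lambda>\<omega>. \<phi> \<omega> * indicator A (V \<omega>))"
      using bnd by (intro integrable_const_bound[of _ 1]) (auto simp: indicator_def)
    have "(\<integral>\<omega>. w \<omega> * indicator A (V \<omega>) \<partial>M)
      = (\<integral>\<omega>. (2 * indicator A (V \<omega>) + \<phi> \<omega> * indicator A (V \<omega>)) / (2 + c) \<partial>M)"
      by (intro Bochner_Integration.integral_cong) (auto simp: w_def algebra_simps)
    then show ?thesis using i1 i2 by simp
  qed
  moreover have "(\<integral>\<omega>. indicator A (V \<omega>) \<partial>M) = \<P>(\<omega> in M. V \<omega> \<in> A)"
    by (subst Bochner_Integration.integral_cong[OF refl, of _ _ "indicator {\<omega>\<in>space M. V \<omega> \<in> A}"]) (auto simp: indicator_def)
  moreover have "measure (distr M borel V) A = \<P>(\<omega> in M. V \<omega> \<in> A)"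
    by (subst measure_distr) (auto intro!: arg_cong[where f="measure M"])
  ultimately show ?thesis using c2 by (simp add: field_simps)
qed

text \<open>
  The real and imaginary parts of \<open>Z\<close> satisfy the hypothesis of the real case, because conjugation
  transfers the hypothesis on \<open>Z\<close> to its conjugate, with \<open>s\<close> replaced by \<open>-s\<close>.
\<close>

lemma (in prob_space) weighted_char_uniqueness:
  fixes V :: "'a \<Rightarrow> real" and Z :: "'a \<Rightarrow> complex" and c :: complex
  assumes V [measurable]: "V \<in> borel_measurable M" and Z [measurable]: "Z \<in> borel_measurable M"
    and bnd: "\<And>\<omega>. norm (Z \<omega>) \<le> 1"
    and eq: "\<And>s. (CLINT \<omega>|M. Z \<omega> * iexp (s * V \<omega>)) = c * char (distr M borel V) s"
    and A [measurable]: "A \<in> sets borel"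
  shows "(CLINT \<omega>|M. Z \<omega> * indicator A (V \<omega>)) = c * \<P>(\<omega> in M. V \<omega> \<in> A)"
proof -
  have ch: "char (distr M borel V) s = (CLINT \<omega>|M. iexp (s * V \<omega>))" for s
    by (simp add: char_def integral_distr)
  have intZ: "integrable M (\<lambda>\<omega>. Z \<omega> * iexp (s * V \<omega>))" for s
    using bnd by (intro integrable_const_bound[of _ 1]) (auto simp: norm_mult)
  have eq': "(CLINT \<omega>|M. cnj (Z \<omega>) * iexp (s * V \<omega>)) = cnj c * char (distr M borel V) s" for s
  proof -
    have "(CLINT \<omega>|M. cnj (Z \<omega>) * iexp (s * V \<omega>)) = (CLINT \<omega>|M. cnj (Z \<omega> * iexp (- s * V \<omega>)))"
      by (intro Bochner_Integration.integral_cong) (auto simp: exp_cnj)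
    also have "\<dots> = cnj (c * char (distr M borel V) (- s))"
      by (simp only: Bochner_Integration.integral_cnj eq)
    also have "cnj (char (distr M borel V) (- s)) = char (distr M borel V) s"
      unfolding ch Bochner_Integration.integral_cnj[symmetric]
      by (intro Bochner_Integration.integral_cong) (auto simp: exp_cnj)
    then have "cnj (c * char (distr M borel V) (- s)) = cnj c * char (distr M borel V) s" by simp
    finally show ?thesis .
  qed
  have [measurable]: "(\<lambda>\<omega>. cnj (Z \<omega>)) \<in> borel_measurable M"
    by (rule measurable_compose[OF Z borel_measurable_continuous_onI]) (intro continuous_intros)
  have intZ': "integrable M (\<lambda>\<omega>. cnj (Z \<omega>) * iexp (s * V \<omega>))" for s
    using bnd by (intro integrable_const_bound[of _ 1]) (auto simp: norm_mult)
  have re: "(\<integral>\<omega>. Re (Z \<omega>) * indicator A (V \<omega>) \<partial>M) = Re c * \<P>(\<omega> in M. V \<omega> \<in> A)"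
  proof (rule weighted_char_uniqueness_real)
    show "\<bar>Re (Z \<omega>)\<bar> \<le> 1" for \<omega> using abs_Re_le_cmod[of "Z \<omega>"] bnd[of \<omega>] by linarith
    fix s
    have "(CLINT \<omega>|M. complex_of_real (Re (Z \<omega>)) * iexp (s * V \<omega>))
      = (CLINT \<omega>|M. (Z \<omega> * iexp (s * V \<omega>) + cnj (Z \<omega>) * iexp (s * V \<omega>)) / 2)"
      by (intro Bochner_Integration.integral_cong refl)
        (simp add: complex_add_cnj distrib_right[symmetric])
    also have "\<dots> = (c + cnj c) / 2 * char (distr M borel V) s"
      using intZ intZ' by (simp add: eq eq' algebra_simps add_divide_distrib del: of_real_mult)
    finally show "(CLINT \<omega>|M. complex_of_real (Re (Z \<omega>)) * iexp (s * V \<omega>))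
      = of_real (Re c) * char (distr M borel V) s" by (simp add: complex_add_cnj)
  qed auto
  have imz: "complex_of_real (Im z) = (z - cnj z) / (2 * \<i>)" for z
    by (simp add: complex_diff_cnj complex_eq_iff)
  have im: "(\<integral>\<omega>. Im (Z \<omega>) * indicator A (V \<omega>) \<partial>M) = Im c * \<P>(\<omega> in M. V \<omega> \<in> A)"
  proof (rule weighted_char_uniqueness_real)
    show "\<bar>Im (Z \<omega>)\<bar> \<le> 1" for \<omega> using abs_Im_le_cmod[of "Z \<omega>"] bnd[of \<omega>] by linarith
    fix s
    have "(CLINT \<omega>|M. complex_of_real (Im (Z \<omega>)) * iexp (s * V \<omega>))
      = (CLINT \<omega>|M. (Z \<omega> * iexp (s * V \<omega>) - cnj (Z \<omega>) * iexp (s * V \<omega>)) / (2 * \<i>))"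
      by (intro Bochner_Integration.integral_cong refl)
        (simp add: imz left_diff_distrib diff_divide_distrib)
    also have "\<dots> = (c - cnj c) / (2 * \<i>) * char (distr M borel V) s"
      using intZ intZ' by (simp add: eq eq' algebra_simps diff_divide_distrib del: of_real_mult)
    finally show "(CLINT \<omega>|M. complex_of_real (Im (Z \<omega>)) * iexp (s * V \<omega>))
      = of_real (Im c) * char (distr M borel V) s" by (simp add: imz)
  qed auto
  have int: "integrable M (\<lambda>\<omega>. Z \<omega> * indicator A (V \<omega>))"
    using bnd by (intro integrable_const_bound[of _ 1]) (auto simp: norm_mult indicator_def)
  show ?thesis
  proof (rule complex_eqI)
    show "Re (CLINT \<omega>|M. Z \<omega> * indicator A (V \<omega>)) = Re (c * \<P>(\<omega> in M. V \<omega> \<in> A))"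
      unfolding integral_Re[OF int, symmetric] by (simp add: re[symmetric]) (auto simp: indicator_def intro!: Bochner_Integration.integral_cong)
    show "Im (CLINT \<omega>|M. Z \<omega> * indicator A (V \<omega>)) = Im (c * \<P>(\<omega> in M. V \<omega> \<in> A))"
      unfolding integral_Im[OF int, symmetric] by (simp add: im[symmetric]) (auto simp: indicator_def intro!: Bochner_Integration.integral_cong)
  qed
qed

text \<open>
  Kac's theorem. The factors \<open>exp (i t\<^sub>k X\<^sub>k)\<close> are exchanged one at a time for indicators of
  \<open>X\<^sub>k \<in> A\<^sub>k\<close>: with the other factors collected in the weight \<open>Z\<close>, each exchange is an instance of
  \<open>weighted_char_uniqueness\<close>. After the last one the expectation is the probability of an
  intersection.
\<close>

lemma (in prob_space) indep_vars_if_char_factorizes: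
  fixes X :: "'i \<Rightarrow> 'a \<Rightarrow> real"
  assumes I: "finite I" "I \<noteq> {}"
    and X [measurable]: "\<And>i. i \<in> I \<Longrightarrow> X i \<in> borel_measurable M"
    and char: "\<And>t. (CLINT \<omega>|M. (\<Prod>i\<in>I. iexp (t i * X i \<omega>))) = (\<Prod>i\<in>I. char (distr M borel (X i)) (t i))"
  shows "indep_vars (\<lambda>_. borel) X I"
proof -
  \<comment> \<open>\<open>K\<close> is the set of indices whose exponential has already been exchanged.\<close>
  have main: "(CLINT \<omega>|M. (\<Prod>i\<in>K. indicator (A i) (X i \<omega>)) * (\<Prod>i\<in>I-K. iexp (t i * X i \<omega>)))
      = (\<Prod>i\<in>K. of_real \<P>(\<omega> in M. X i \<omega> \<in> A i)) * (\<Prod>i\<in>I-K. char (distr M borel (X i)) (t i))"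
    if "finite K" "K \<subseteq> I" and A: "\<And>i. i \<in> I \<Longrightarrow> A i \<in> sets borel" for K A t
    using that(1,2)
  proof (induction K arbitrary: t)
    case empty
    then show ?case using char[of t] by (simp del: of_real_mult)
  next
    case (insert k K)
    have k [measurable]: "k \<in> I" "X k \<in> borel_measurable M" using insert.prems by auto
    have KI: "K \<subseteq> I" using insert.prems by auto
    note A' [measurable] = A
    have Im: "I - K = insert k (I - insert k K)" using insert.hyps k by auto
    define Z :: "'a \<Rightarrow> complex" where "Z \<omega> = (\<Prod>i\<in>K. indicator (A i) (X i \<omega>)) * (\<Prod>i\<in>I - insert k K. iexp (t i * X i \<omega>))" for \<omega>
    define c where "c = (\<Prod>i\<in>K. complex_of_real \<P>(\<omega> in M. X i \<omega> \<in> A i)) * (\<Prod>i\<in>I-insert k K. char (distr M borel (X i)) (t i))"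
    have Zm: "Z \<in> borel_measurable M"
    proof -
      have "(\<lambda>\<omega>. \<Prod>i\<in>K. indicator (A i) (X i \<omega>) :: complex) \<in> borel_measurable M"
      proof (rule borel_measurable_prod)
        fix i assume "i \<in> K"
        then have "i \<in> I" using KI by auto
        then show "(\<lambda>\<omega>. indicator (A i) (X i \<omega>) :: complex) \<in> borel_measurable M" by measurable
      qed
      then show ?thesis unfolding Z_def[abs_def] by measurable
    qed
    have "(CLINT \<omega>|M. Z \<omega> * indicator (A k) (X k \<omega>)) = c * \<P>(\<omega> in M. X k \<omega> \<in> A k)"
    proof (rule weighted_char_uniqueness[OF k(2) Zm])
      show "norm (Z \<omega>) \<le> 1" for \<omega>
        by (simp add: Z_def norm_mult prod_norm[symmetric])
          (auto intro!: prod_le_1 simp: indicator_def)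
      show "A k \<in> sets borel" using A k by auto
      fix s
      have "(CLINT \<omega>|M. Z \<omega> * iexp (s * X k \<omega>)) =
        (CLINT \<omega>|M. (\<Prod>i\<in>K. indicator (A i) (X i \<omega>)) * (\<Prod>i\<in>I-K. iexp ((t(k:=s)) i * X i \<omega>)))"
        unfolding Im using I by (intro Bochner_Integration.integral_cong) (auto simp: Z_def intro!: prod.cong)
      also have "\<dots> = c * char (distr M borel (X k)) s"
        unfolding insert.IH[OF KI] unfolding Im using I by (auto simp: c_def intro!: prod.cong)
      finally show "(CLINT \<omega>|M. Z \<omega> * iexp (s * X k \<omega>)) = c * char (distr M borel (X k)) s" .
    qed
    then show ?case using insert.hyps by (simp add: Z_def c_def mult_ac)
  qed
  show ?thesis
  proof (subst indep_vars_finite[where E="\<lambda>_. sets borel", OF I(2,1)]; (intro ballI)?)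
    fix A assume "A \<in> (\<Pi> i\<in>I. sets (borel::real measure))"
    then have A [measurable]: "\<And>i. i \<in> I \<Longrightarrow> A i \<in> sets borel" by auto
    have "of_real (prob (\<Inter>j\<in>I. X j -` A j \<inter> space M)) = (CLINT \<omega>|M. complex_of_real (indicator (\<Inter>j\<in>I. X j -` A j \<inter> space M) \<omega>))"
      using I by (simp add: Int_absorb2 INT_subset_iff[symmetric] del: of_real_indicator)
    also have "\<dots> = (CLINT \<omega>|M. (\<Prod>i\<in>I. indicator (A i) (X i \<omega>)))"
      using I by (intro Bochner_Integration.integral_cong) (auto simp: indicator_def prod.If_cases intro!: prod_zero[symmetric] prod.neutral[symmetric])
    also have "\<dots> = of_real (\<Prod>i\<in>I. \<P>(\<omega> in M. X i \<omega> \<in> A i))"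
      using main[of I A] I A by simp
    finally show "prob (\<Inter>j\<in>I. X j -` A j \<inter> space M) = (\<Prod>j\<in>I. prob (X j -` A j \<inter> space M))"
      unfolding of_real_eq_iff by (simp add: vimage_def Int_def conj_commute)
  qed (auto simp: Int_stable_def sets.sigma_sets_eq[of borel, simplified])
qed

section \<open>The standard normal tail and the law of the tail of a folded normal variable\<close>

interpretation std_normal: real_distribution std_normal_distribution
  by (rule real_dist_normal_dist)

lemma std_normal_no_atoms: "measure std_normal_distribution {x} = 0"
  by (simp add: measure_def emeasure_density nn_integral_0_iff_AE)

lemma std_normal_tail_strict_antimono:
  assumes "x < y" shows "std_normal_tail y < std_normal_tail x"
proof -
  have "measure std_normal_distribution {x<..y} \<noteq> 0"
  proof
    assume "measure std_normal_distribution {x<..y} = 0"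
    then have "emeasure std_normal_distribution {x<..y} = 0"
      by (simp add: std_normal.emeasure_eq_measure)
    then have "AE z in lborel. \<not> (x < z \<and> z \<le> y)"
      using pi_gt_zero
      by (simp add: emeasure_density nn_integral_0_iff_AE indicator_def normal_density_def mult_eq_0_iff ennreal_eq_0_iff not_less divide_le_0_iff)
    then have "emeasure lborel {x<..y} = 0"
      by (subst (asm) AE_iff_measurable[OF _ refl]) (auto simp: greaterThanAtMost_def greaterThan_def atMost_def Int_def)
    with assms show False by simp
  qed
  then show ?thesis
    using std_normal.cdf_diff_eq[OF assms] zero_less_measure_iff[of std_normal_distribution "{x<..y}"]
    by (simp add: std_normal_tail_def)
qed

lemma std_normal_tail_less_iff [simp]: "std_normal_tail x < std_normal_tail y \<longleftrightarrow> y < x"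
  by (metis std_normal_tail_strict_antimono not_less_iff_gr_or_eq order.asym)

lemma std_normal_tail_le_iff [simp]: "std_normal_tail x \<le> std_normal_tail y \<longleftrightarrow> y \<le> x"
  by (simp add: not_less[symmetric])

lemma std_normal_tail_pos: "0 < std_normal_tail x"
  using std_normal_tail_strict_antimono[of x "x + 1"] std_normal.cdf_bounded_prob[of "x + 1"]
  by (simp add: std_normal_tail_def)

lemma std_normal_tail_less_1: "std_normal_tail x < 1"
  using std_normal_tail_strict_antimono[of "x - 1" x] std_normal.cdf_nonneg[of "x - 1"]
  by (simp add: std_normal_tail_def)

lemma std_normal_tail_isCont: "isCont std_normal_tail x"
  unfolding std_normal_tail_def[abs_def]
  by (intro continuous_intros) (simp add: std_normal.isCont_cdf std_normal_no_atoms)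

lemma std_normal_tail_measurable [measurable]: "std_normal_tail \<in> borel_measurable borel"
  by (intro borel_measurable_continuous_onI continuous_at_imp_continuous_on ballI std_normal_tail_isCont)

lemma std_normal_tail_surj:
  assumes "0 < t" "t < 1" shows "\<exists>x. std_normal_tail x = t"
proof -
  have "eventually (\<lambda>x. cdf std_normal_distribution x > 1 - t) at_top"
    using order_tendstoD(1)[OF std_normal.cdf_lim_at_top_prob, of "1 - t"] assms by simp
  then obtain b where b: "cdf std_normal_distribution b > 1 - t" by (auto simp: eventually_at_top_linorder)
  have "eventually (\<lambda>x. cdf std_normal_distribution x < 1 - t) at_bot"
    using order_tendstoD(2)[OF std_normal.cdf_lim_at_bot, of "1 - t"] assms by simp
  then obtain a where a: "cdf std_normal_distribution a < 1 - t" by (auto simp: eventually_at_bot_linorder)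
  have "a \<le> b" using a b std_normal_tail_less_iff[of b a] by (simp add: std_normal_tail_def)
  then have "\<exists>x\<ge>a. x \<le> b \<and> std_normal_tail x = t"
    using a b by (intro IVT2) (auto simp: std_normal_tail_isCont std_normal_tail_def[of a] std_normal_tail_def[of b])
  then show ?thesis by blast
qed

text \<open>
  The tail is a bijection from the real line onto \<open>(0,1)\<close>, so this inverse is determined there;
  outside of \<open>(0,1)\<close> its values are arbitrary.
\<close>

abbreviation std_normal_upper_quantile :: "real \<Rightarrow> real" where
  "std_normal_upper_quantile \<equiv> inv std_normal_tail"

lemma std_normal_upper_quantile_tail [simp]: "std_normal_upper_quantile (std_normal_tail x) = x"
  by (rule inv_f_f) (metis injI not_less_iff_gr_or_eq std_normal_tail_less_iff)

lemma std_normal_tail_upper_quantile: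
  assumes "0 < t" "t < 1" shows "std_normal_tail (std_normal_upper_quantile t) = t"
  using std_normal_tail_surj[OF assms] by auto

text \<open>
  The probability integral transform: the tail probability of a standard normal variable is uniform
  on \<open>(0,1)\<close>.
\<close>

lemma distr_std_normal_tail:
  "distr std_normal_distribution borel std_normal_tail = density lborel (indicator {0<..<1})"
proof (rule cdf_unique)
  show "real_distribution (distr std_normal_distribution borel std_normal_tail)"
    by (intro std_normal.real_distribution_distr) simp
  have "prob_space (density lborel (indicator {0<..<1::real}))"
    by (intro prob_spaceI) (simp add: emeasure_density)
  then show "real_distribution (density lborel (indicator {0<..<1}))"
    by (simp add: real_distribution_def real_distribution_axioms_def)
  show "cdf (distr std_normal_distribution borel std_normal_tail) = cdf (density lborel (indicator {0<..<1}))"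
  proof
    fix t :: real
    have L: "cdf (distr std_normal_distribution borel std_normal_tail) t
        = measure std_normal_distribution {x. std_normal_tail x \<le> t}"
      by (simp add: cdf_def measure_distr vimage_def)
    have R: "cdf (density lborel (indicator {0<..<1})) t = measure lborel ({0<..<1} \<inter> {..t})"
      by (simp add: cdf_def measure_def emeasure_density indicator_inter_arith[symmetric])
    consider "t \<le> 0" | "1 \<le> t" | "0 < t" "t < 1" by linarith
    then show "cdf (distr std_normal_distribution borel std_normal_tail) t
      = cdf (density lborel (indicator {0<..<1})) t"
    proof cases
      case 1
      have "\<not> std_normal_tail x \<le> t" for x using std_normal_tail_pos[of x] 1 by linarith
      with 1 have "{x. std_normal_tail x \<le> t} = {}" "{0<..<1} \<inter> {..t} = {}"
        by auto
      then show ?thesis by (simp add: L R)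
    next
      case 2
      have "std_normal_tail x \<le> t" for x using std_normal_tail_less_1[of x] 2 by linarith
      with 2 have "{x. std_normal_tail x \<le> t} = UNIV" "{0<..<1} \<inter> {..t} = {0<..<1}"
        by auto
      then show ?thesis using std_normal.prob_space by (simp add: L R)
    next
      case 3
      define q where "q = std_normal_upper_quantile t"
      have q: "std_normal_tail q = t" unfolding q_def by (rule std_normal_tail_upper_quantile[OF 3])
      have "{x. std_normal_tail x \<le> t} = space std_normal_distribution - {..<q}"
        by (auto simp: q[symmetric])
      then have "cdf (distr std_normal_distribution borel std_normal_tail) t = 1 - measure std_normal_distribution {..<q}"
        using std_normal.prob_compl[of "{..<q}"] by (simp add: L)
      also have "measure std_normal_distribution {..<q} = measure std_normal_distribution ({..q} - {q})"
        by (intro arg_cong[where f="measure _"]) auto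
      also have "\<dots> = cdf std_normal_distribution q"
        by (subst std_normal.finite_measure_Diff) (auto simp: cdf_def std_normal_no_atoms)
      also have "1 - \<dots> = t" using q by (simp add: std_normal_tail_def)
      moreover have "{0<..<1} \<inter> {..t} = {0<..t}" using 3 by auto
      ultimately show ?thesis using 3 by (simp add: R)
    qed
  qed
qed

text \<open>
  The density of the tail probability at \<open>\<bar>N\<bar>\<close>, where \<open>N\<close> is normal with mean \<open>\<mu>\<close> and variance one.
  The exponential and the cosh together are the likelihood ratio of \<open>\<bar>N\<bar>\<close> against its law for
  \<open>\<mu> = 0\<close>; the factor \<open>2\<close> accounts for the two signs of \<open>N\<close>.
\<close>

definition folded_tail_density :: "real \<Rightarrow> real \<Rightarrow> real" where
  "folded_tail_density \<mu> t =
     (if 0 < t \<and> t < std_normal_tail 0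
      then 2 * exp (- \<mu>\<^sup>2 / 2) * cosh (\<mu> * std_normal_upper_quantile t) else 0)"

lemma folded_tail_density_nonneg [simp]: "0 \<le> folded_tail_density \<mu> t"
  by (simp add: folded_tail_density_def)

lemma cosh_mult_mono:
  fixes \<mu> x y :: real
  assumes "0 \<le> x" "x \<le> y" shows "cosh (\<mu> * x) \<le> cosh (\<mu> * y)"
proof -
  have "cosh \<bar>\<mu> * x\<bar> \<le> cosh \<bar>\<mu> * y\<bar>"
    using assms by (subst cosh_real_nonneg_le_iff) (auto simp: abs_mult intro!: mult_left_mono)
  then show ?thesis by (simp add: cosh_real_abs)
qed

lemma std_normal_upper_quantile_antimono:
  assumes "0 < s" "s < t" "t < std_normal_tail 0"
  shows "0 < std_normal_upper_quantile t" "std_normal_upper_quantile t < std_normal_upper_quantile s"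
proof -
  have "t < 1" using assms std_normal_tail_less_1[of 0] by linarith
  then have "std_normal_tail (std_normal_upper_quantile t) = t" "std_normal_tail (std_normal_upper_quantile s) = s"
    using assms by (auto intro: std_normal_tail_upper_quantile)
  then show "0 < std_normal_upper_quantile t" "std_normal_upper_quantile t < std_normal_upper_quantile s"
    using assms by (metis std_normal_tail_less_iff)+
qed

lemma folded_tail_density_antimono:
  assumes "0 < s" "s \<le> t"
  shows "folded_tail_density \<mu> t \<le> folded_tail_density \<mu> s"
proof (cases "s < t \<and> t < std_normal_tail 0")
  case True
  then show ?thesis
    using std_normal_upper_quantile_antimono[of s t] assms
    by (auto simp: folded_tail_density_def intro!: cosh_mult_mono)
qed (use assms in \<open>auto simp: folded_tail_density_def\<close>)

lemma folded_tail_density_strict_antimono: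
  assumes "\<mu> \<noteq> 0" "0 < s" "s < t" "t < std_normal_tail 0"
  shows "folded_tail_density \<mu> t < folded_tail_density \<mu> s"
proof -
  note q = std_normal_upper_quantile_antimono[OF assms(2-4)]
  have "cosh \<bar>\<mu> * std_normal_upper_quantile t\<bar> < cosh \<bar>\<mu> * std_normal_upper_quantile s\<bar>"
    using q assms(1) by (subst cosh_real_nonneg_less_iff) (auto simp: abs_mult)
  then show ?thesis using assms by (simp add: folded_tail_density_def cosh_real_abs)
qed

text \<open>
  Measurability comes from monotonicity, which spares a separate study of the quantile function.
\<close>

lemma folded_tail_density_measurable [measurable]: "folded_tail_density \<mu> \<in> borel_measurable borel"
proof -
  have "mono_on {0<..} (\<lambda>t. - folded_tail_density \<mu> t)"
    by (auto simp: mono_on_def intro!: folded_tail_density_antimono)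
  then have "(\<lambda>t. - folded_tail_density \<mu> t) \<in> borel_measurable (restrict_space borel {0<..})"
    by (rule borel_measurable_mono_on_fnc)
  then have "(\<lambda>t. if t \<in> {0<..} then - folded_tail_density \<mu> t else 0) \<in> borel_measurable borel"
    by (subst (asm) measurable_restrict_space_iff) auto
  then have "(\<lambda>t. - (if t \<in> {0<..} then - folded_tail_density \<mu> t else 0)) \<in> borel_measurable borel"
    by (rule borel_measurable_uminus)
  also have "(\<lambda>t. - (if t \<in> {0<..} then - folded_tail_density \<mu> t else 0)) = folded_tail_density \<mu>"
    by (auto simp: folded_tail_density_def fun_eq_iff)
  finally show ?thesis .
qed

text \<open>
  Adding the densities at \<open>x\<close> and \<open>-x\<close> is what produces the hyperbolic cosine.
\<close>

lemma normal_density_reflect_sum: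
  "normal_density \<mu> 1 x + normal_density \<mu> 1 (- x) = std_normal_density x * (2 * exp (- \<mu>\<^sup>2 / 2) * cosh (\<mu> * x))"
  by (simp add: normal_density_def cosh_def power2_eq_square algebra_simps exp_add[symmetric] exp_diff[symmetric] diff_divide_distrib add_divide_distrib)

text \<open>
  Folding at the origin leaves the half line \<open>x > 0\<close>, where the density is the standard normal one
  times the likelihood ratio. The likelihood ratio is a function of the tail at \<open>x\<close>, and the image of
  the standard normal law under the tail is uniform.
\<close>

lemma distr_folded_tail:
  "distr (density lborel (\<lambda>x. ennreal (normal_density \<mu> 1 x))) borel (\<lambda>x. std_normal_tail \<bar>x\<bar>)
    = density lborel (\<lambda>t. ennreal (folded_tail_density \<mu> t))"
proof (rule measure_eqI)
  fix A assume "A \<in> sets (distr (density lborel (\<lambda>x. ennreal (normal_density \<mu> 1 x))) borel (\<lambda>x. std_normal_tail \<bar>x\<bar>))"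
  then have [measurable]: "A \<in> sets borel" by simp
  define F where "F x = ennreal (normal_density \<mu> 1 x) * indicator A (std_normal_tail \<bar>x\<bar>)" for x
  have F [measurable]: "F \<in> borel_measurable borel" by (simp add: F_def[abs_def])
  have "emeasure (distr (density lborel (\<lambda>x. ennreal (normal_density \<mu> 1 x))) borel (\<lambda>x. std_normal_tail \<bar>x\<bar>)) A
    = (\<integral>\<^sup>+x. F x \<partial>lborel)"
    unfolding F_def
    by (subst nn_integral_indicator[symmetric], simp, subst nn_integral_distr, simp, simp, subst nn_integral_density) auto
  also have "\<dots> = (\<integral>\<^sup>+x. F x * indicator {0<..} x + F x * indicator {..<0} x \<partial>lborel)"
    using AE_lborel_singleton[of "0::real"] by (intro nn_integral_cong_AE, eventually_elim) (auto simp: indicator_def)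
  also have "\<dots> = (\<integral>\<^sup>+x. F x * indicator {0<..} x \<partial>lborel) + (\<integral>\<^sup>+x. F x * indicator {..<0} x \<partial>lborel)"
    by (rule nn_integral_add) auto
  also have "(\<integral>\<^sup>+x. F x * indicator {..<0} x \<partial>lborel) = (\<integral>\<^sup>+x. F (- x) * indicator {0<..} x \<partial>lborel)"
    by (subst nn_integral_real_affine[where c="-1" and t=0]) (auto simp: indicator_def intro!: nn_integral_cong)
  also have "(\<integral>\<^sup>+x. F x * indicator {0<..} x \<partial>lborel) + \<dots> = (\<integral>\<^sup>+x. F x * indicator {0<..} x + F (- x) * indicator {0<..} x \<partial>lborel)"
    by (rule nn_integral_add[symmetric]) auto
  also have "\<dots> = (\<integral>\<^sup>+x. ennreal (std_normal_density x) * (ennreal (folded_tail_density \<mu> (std_normal_tail x)) * indicator A (std_normal_tail x)) \<partial>lborel)"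
  proof (intro nn_integral_cong)
    fix x :: real
    have "0 < x \<Longrightarrow> ennreal (normal_density \<mu> 1 x) + ennreal (normal_density \<mu> 1 (- x))
       = ennreal (std_normal_density x) * ennreal (folded_tail_density \<mu> (std_normal_tail x))"
      using std_normal_tail_pos[of x]
      by (subst ennreal_plus[symmetric]) (auto simp: normal_density_reflect_sum folded_tail_density_def ennreal_mult'[symmetric])
    then show "F x * indicator {0<..} x + F (- x) * indicator {0<..} x = ennreal (std_normal_density x) * (ennreal (folded_tail_density \<mu> (std_normal_tail x)) * indicator A (std_normal_tail x))"
      by (auto simp: F_def indicator_def folded_tail_density_def)
  qed
  also have "\<dots> = (\<integral>\<^sup>+x. ennreal (folded_tail_density \<mu> (std_normal_tail x)) * indicator A (std_normal_tail x) \<partial>std_normal_distribution)"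
    by (subst nn_integral_density) auto
  also have "\<dots> = (\<integral>\<^sup>+t. ennreal (folded_tail_density \<mu> t) * indicator A t \<partial>distr std_normal_distribution borel std_normal_tail)"
    by (subst nn_integral_distr) auto
  also have "\<dots> = (\<integral>\<^sup>+t. indicator {0<..<1} t * (ennreal (folded_tail_density \<mu> t) * indicator A t) \<partial>lborel)"
    unfolding distr_std_normal_tail by (subst nn_integral_density) auto
  also have "\<dots> = (\<integral>\<^sup>+t. ennreal (folded_tail_density \<mu> t) * indicator A t \<partial>lborel)"
    using std_normal_tail_less_1[of 0] by (intro nn_integral_cong) (auto simp: indicator_def folded_tail_density_def)
  also have "\<dots> = emeasure (density lborel (\<lambda>t. ennreal (folded_tail_density \<mu> t))) A"
    by (simp add: emeasure_density)
  finally show "emeasure (distr (density lborel (\<lambda>x. ennreal (normal_density \<mu> 1 x))) borel (\<lambda>x. std_normal_tail \<bar>x\<bar>)) A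
    = emeasure (density lborel (\<lambda>t. ennreal (folded_tail_density \<mu> t))) A" .
qed simp

section \<open>The ratio of the smallest to the second smallest of independent variables\<close>

text \<open>
  Conditionally on \<open>m\<close>, the variable \<open>T / m\<close> has the rescaled density \<open>s \<mapsto> m k(s m)\<close>; independence
  allows this density to be averaged over \<open>m\<close>.
\<close>

lemma (in prob_space) distr_quotient_indep:
  fixes T m :: "'a \<Rightarrow> real" and k :: "real \<Rightarrow> ennreal"
  assumes ind: "indep_var borel T borel m"
    and k [measurable]: "k \<in> borel_measurable borel"
    and T: "distr M borel T = density lborel k"
    and m_pos: "\<And>\<omega>. \<omega> \<in> space M \<Longrightarrow> 0 < m \<omega>"
  shows "distr M borel (\<lambda>\<omega>. T \<omega> / m \<omega>) = density lborel (\<lambda>s. \<integral>\<^sup>+\<omega>. ennreal (m \<omega>) * k (s * m \<omega>) \<partial>M)"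
proof (rule measure_eqI)
  fix C assume "C \<in> sets (distr M borel (\<lambda>\<omega>. T \<omega> / m \<omega>))"
  then have C [measurable]: "C \<in> sets borel" by simp
  have [measurable]: "T \<in> borel_measurable M" "m \<in> borel_measurable M"
    using ind by (auto dest: indep_var_rv1 indep_var_rv2)
  interpret H: prob_space "distr M borel m" by (rule prob_space_distr) simp
  interpret D: prob_space "distr M borel T" by (rule prob_space_distr) simp
  interpret P: pair_sigma_finite "distr M borel T" "distr M borel m" ..
  interpret LM: pair_sigma_finite lborel M ..
  have "emeasure (distr M borel (\<lambda>\<omega>. T \<omega> / m \<omega>)) C = (\<integral>\<^sup>+\<omega>. indicator C (T \<omega> / m \<omega>) \<partial>M)"
    by (subst nn_integral_indicator[symmetric], simp, subst nn_integral_distr) auto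
  also have "\<dots> = (\<integral>\<^sup>+z. indicator C (fst z / snd z) \<partial>distr M (borel \<Otimes>\<^sub>M borel) (\<lambda>\<omega>. (T \<omega>, m \<omega>)))"
    by (subst nn_integral_distr) auto
  also have "distr M (borel \<Otimes>\<^sub>M borel) (\<lambda>\<omega>. (T \<omega>, m \<omega>)) = distr M borel T \<Otimes>\<^sub>M distr M borel m"
    using ind by (simp add: indep_var_distribution_eq)
  also have "(\<integral>\<^sup>+z. indicator C (fst z / snd z) \<partial>(distr M borel T \<Otimes>\<^sub>M distr M borel m))
     = (\<integral>\<^sup>+x. (\<integral>\<^sup>+t. indicator C (t / x) \<partial>distr M borel T) \<partial>distr M borel m)"
    by (subst P.nn_integral_snd[symmetric]) auto
  also have "\<dots> = (\<integral>\<^sup>+\<omega>. (\<integral>\<^sup>+t. indicator C (t / m \<omega>) \<partial>distr M borel T) \<partial>M)"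
    by (subst nn_integral_distr) auto
  also have "\<dots> = (\<integral>\<^sup>+\<omega>. (\<integral>\<^sup>+s. ennreal (m \<omega>) * k (s * m \<omega>) * indicator C s \<partial>lborel) \<partial>M)"
  proof (intro nn_integral_cong)
    fix \<omega> assume "\<omega> \<in> space M"
    then have m: "0 < m \<omega>" by (rule m_pos)
    have "(\<integral>\<^sup>+t. indicator C (t / m \<omega>) \<partial>distr M borel T) = (\<integral>\<^sup>+t. k t * indicator C (t / m \<omega>) \<partial>lborel)"
      unfolding T by (subst nn_integral_density) auto
    also have "\<dots> = ennreal (m \<omega>) * (\<integral>\<^sup>+s. k (s * m \<omega>) * indicator C s \<partial>lborel)"
      using m by (subst nn_integral_real_affine[where c="m \<omega>" and t=0]) (auto simp: mult.commute)
    also have "\<dots> = (\<integral>\<^sup>+s. ennreal (m \<omega>) * k (s * m \<omega>) * indicator C s \<partial>lborel)"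
      by (subst nn_integral_cmult[symmetric]) (auto simp: mult.assoc)
    finally show "(\<integral>\<^sup>+t. indicator C (t / m \<omega>) \<partial>distr M borel T) = \<dots>" .
  qed
  also have "\<dots> = (\<integral>\<^sup>+s. (\<integral>\<^sup>+\<omega>. ennreal (m \<omega>) * k (s * m \<omega>) * indicator C s \<partial>M) \<partial>lborel)"
    by (rule LM.Fubini') measurable
  also have "\<dots> = (\<integral>\<^sup>+s. (\<integral>\<^sup>+\<omega>. ennreal (m \<omega>) * k (s * m \<omega>) \<partial>M) * indicator C s \<partial>lborel)"
    by (intro nn_integral_cong nn_integral_multc) measurable
  also have "\<dots> = emeasure (density lborel (\<lambda>s. \<integral>\<^sup>+\<omega>. ennreal (m \<omega>) * k (s * m \<omega>) \<partial>M)) C"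
    by (subst emeasure_density) auto
  finally show "emeasure (distr M borel (\<lambda>\<omega>. T \<omega> / m \<omega>)) C
    = emeasure (density lborel (\<lambda>s. \<integral>\<^sup>+\<omega>. ennreal (m \<omega>) * k (s * m \<omega>) \<partial>M)) C" .
qed simp

definition min_others :: "('i::finite \<Rightarrow> real) \<Rightarrow> 'i \<Rightarrow> real" where
  "min_others x i = (MIN j \<in> UNIV - {i}. x j)"

lemma min_others_le: "i \<noteq> j \<Longrightarrow> min_others x i \<le> x j"
  by (auto simp: min_others_def)

lemma others_nonempty:
  assumes "CARD('i::finite) \<ge> 2" shows "UNIV - {i::'i} \<noteq> {}"
proof
  assume "UNIV - {i} = {}"
  then have "CARD('i) \<le> card {i}" by (intro card_mono) auto
  with assms show False by simp
qed

lemma min_others_mem: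
  fixes x :: "'i::finite \<Rightarrow> real"
  assumes "CARD('i) \<ge> 2" obtains j where "j \<noteq> i" "min_others x i = x j"
proof -
  have "min_others x i \<in> x ` (UNIV - {i})"
    unfolding min_others_def using others_nonempty[OF assms] by (intro Min_in) auto
  with that show ?thesis by auto
qed

text \<open>
  The denominator is the second smallest value, counted with multiplicity: \<open>min_others x i\<close> is the
  overall minimum unless \<open>i\<close> is the index of a strict minimum, when it is the runner-up. This
  symmetric form, in which no minimizing index is chosen, makes measurability evident.
\<close>

definition min_ratio :: "('i::finite \<Rightarrow> real) \<Rightarrow> real" where
  "min_ratio x = (MIN i. x i) / (MAX i. min_others x i)"

lemma min_ratio_eq:
  fixes x :: "'i::finite \<Rightarrow> real"
  assumes card: "CARD('i) \<ge> 2" and min: "\<And>j. x i \<le> x j"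
  shows "min_ratio x = x i / min_others x i"
proof -
  have "(MIN j. x j) = x i" by (rule Min_eqI) (auto simp: min)
  moreover have "(MAX j. min_others x j) = min_others x i"
  proof (rule Max_eqI)
    fix y assume "y \<in> range (min_others x)"
    then obtain j where y: "y = min_others x j" by auto
    obtain l where l: "l \<noteq> i" "min_others x i = x l" using min_others_mem[OF card] by metis
    show "y \<le> min_others x i"
    proof (cases "j = i")
      case False
      then have "y \<le> x i" unfolding y by (rule min_others_le)
      also have "\<dots> \<le> min_others x i" unfolding l by (rule min)
      finally show ?thesis .
    qed (simp add: y)
  qed auto
  ultimately show ?thesis by (simp add: min_ratio_def)
qed

lemma min_others_measurable:
  fixes T :: "'i::finite \<Rightarrow> 'a \<Rightarrow> real"
  assumes card: "CARD('i) \<ge> 2" and [measurable]: "\<And>i. T i \<in> borel_measurable M"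
  shows "(\<lambda>\<omega>. min_others (\<lambda>j. T j \<omega>) i) \<in> borel_measurable M"
  unfolding min_others_def using others_nonempty[OF card, of i]
  by (intro borel_measurable_Min) auto

text \<open>
  The summation stays inside the expectation so that a single strict inequality between integrands
  proves strict monotonicity.
\<close>

definition min_ratio_density ::
    "'a measure \<Rightarrow> ('i::finite \<Rightarrow> 'a \<Rightarrow> real) \<Rightarrow> ('i \<Rightarrow> real \<Rightarrow> real) \<Rightarrow> real \<Rightarrow> ennreal" where
  "min_ratio_density M T k s =
     (\<integral>\<^sup>+\<omega>. ennreal (\<Sum>i\<in>UNIV. min_others (\<lambda>j. T j \<omega>) i * k i (s * min_others (\<lambda>j. T j \<omega>) i)) \<partial>M)"

text \<open>
  Up to the null event of a tie, the space is partitioned by the index \<open>i\<close> of the smallest variable.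
  The event that \<open>i\<close> is this index is \<open>T\<^sub>i / m\<^sub>i < 1\<close>, and there the ratio is \<open>T\<^sub>i / m\<^sub>i\<close>. So the law
  of the ratio is the sum of the laws of these quotients, each restricted to values below \<open>1\<close>.
\<close>

lemma (in prob_space) distr_min_ratio:
  fixes T :: "'i::finite \<Rightarrow> 'a \<Rightarrow> real" and k :: "'i \<Rightarrow> real \<Rightarrow> real"
  assumes card: "CARD('i) \<ge> 2"
    and ind: "indep_vars (\<lambda>_. borel) T UNIV"
    and k [measurable]: "\<And>i. k i \<in> borel_measurable borel"
    and k_nonneg: "\<And>i t. 0 \<le> k i t"
    and k_neg: "\<And>i t. t \<le> 0 \<Longrightarrow> k i t = 0"
    and T: "\<And>i. distr M borel (T i) = density lborel (\<lambda>t. ennreal (k i t))"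
    and T_pos: "\<And>i \<omega>. \<omega> \<in> space M \<Longrightarrow> 0 < T i \<omega>"
    and untied: "\<And>i j. i \<noteq> j \<Longrightarrow> AE \<omega> in M. T i \<omega> \<noteq> T j \<omega>"
  shows "(\<lambda>\<omega>. min_ratio (\<lambda>j. T j \<omega>)) \<in> borel_measurable M" (is ?meas)
    and "min_ratio_density M T k \<in> borel_measurable borel" (is ?measF)
    and "distr M borel (\<lambda>\<omega>. min_ratio (\<lambda>j. T j \<omega>))
           = density lborel (\<lambda>s. min_ratio_density M T k s * indicator {0<..<1} s)" (is ?law)
proof -
  have Tm [measurable]: "T i \<in> borel_measurable M" for i using ind by (auto simp: indep_vars_def)
  define S where "S \<omega> = min_ratio (\<lambda>j. T j \<omega>)" for \<omega>
  define m where "m i \<omega> = min_others (\<lambda>j. T j \<omega>) i" for i \<omega>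
  have mm [measurable]: "m i \<in> borel_measurable M" for i
    unfolding m_def[abs_def] by (intro min_others_measurable card) auto
  have S [measurable]: "S \<in> borel_measurable M"
    unfolding S_def[abs_def] min_ratio_def m_def[symmetric]
    by (intro borel_measurable_divide borel_measurable_Min borel_measurable_Max) auto
  then show ?meas by (simp add: S_def[abs_def])
  have mpos: "0 < m i \<omega>" if "\<omega> \<in> space M" for i \<omega>
    using that T_pos by (metis m_def min_others_mem[OF card])
  have S_eq: "S \<omega> = T i \<omega> / m i \<omega>" if "T i \<omega> < m i \<omega>" for i \<omega>
  proof -
    have "T i \<omega> \<le> T j \<omega>" for j
      using that min_others_le[of i j "\<lambda>j. T j \<omega>"] by (cases "i = j") (auto simp: m_def)
    then show ?thesis unfolding S_def m_def by (intro min_ratio_eq[OF card]) auto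
  qed
  have untied': "AE \<omega> in M. \<exists>i. T i \<omega> < m i \<omega>"
  proof -
    have "AE \<omega> in M. \<forall>i j. i \<noteq> j \<longrightarrow> T i \<omega> \<noteq> T j \<omega>"
      using untied by (intro AE_all_countable[THEN iffD2] allI) (auto intro: AE_impI)
    then show ?thesis
    proof eventually_elim
      case (elim \<omega>)
      have "(MIN i. T i \<omega>) \<in> range (\<lambda>i. T i \<omega>)" by (intro Min_in) auto
      then obtain i where i: "(MIN i. T i \<omega>) = T i \<omega>" by (rule rangeE)
      have le: "T i \<omega> \<le> T j \<omega>" for j unfolding i[symmetric] by (intro Min_le) auto
      obtain j where "j \<noteq> i" "m i \<omega> = T j \<omega>" using min_others_mem[OF card] unfolding m_def by metis
      with elim le[of j] show ?case by (intro exI[of _ i]) (auto simp: less_le)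
    qed
  qed
  have "indep_var borel (T i) borel (\<lambda>\<omega>. Min ((\<lambda>j. T j \<omega>) ` (UNIV - {i})))" for i
    using ind by (intro indep_vars_Min) (auto simp: insert_UNIV)
  then have indi: "indep_var borel (T i) borel (m i)" for i
    by (simp add: m_def[abs_def] min_others_def)
  define f where "f i s = (\<integral>\<^sup>+\<omega>. ennreal (m i \<omega>) * ennreal (k i (s * m i \<omega>)) \<partial>M)" for i s
  have f [measurable]: "f i \<in> borel_measurable borel" for i by (simp add: f_def[abs_def])
  have quot: "distr M borel (\<lambda>\<omega>. T i \<omega> / m i \<omega>) = density lborel (f i)" for i
    unfolding f_def[abs_def] by (intro distr_quotient_indep indi T mpos) auto
  have f_neg: "f i s = 0" if "s \<le> 0" for i s
    unfolding f_def using that mpos k_neg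
    by (subst nn_integral_0_iff_AE) (auto intro!: AE_I2 simp: k_neg mult_nonpos_nonneg less_imp_le)
  have F: "min_ratio_density M T k s = (\<Sum>i\<in>UNIV. f i s)" for s
  proof -
    have "min_ratio_density M T k s = (\<integral>\<^sup>+\<omega>. (\<Sum>i\<in>UNIV. ennreal (m i \<omega>) * ennreal (k i (s * m i \<omega>))) \<partial>M)"
      unfolding min_ratio_density_def m_def[symmetric] using mpos k_nonneg
      by (intro nn_integral_cong, subst sum_ennreal[symmetric]) (auto simp: ennreal_mult' less_imp_le)
    also have "\<dots> = (\<Sum>i\<in>UNIV. f i s)" unfolding f_def by (rule nn_integral_sum) measurable
    finally show ?thesis .
  qed
  show Fm: ?measF unfolding F[abs_def] by measurable
  define E where "E A i = {\<omega>\<in>space M. T i \<omega> / m i \<omega> \<in> A \<inter> {..<1}}" for A i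
  have E [measurable]: "E A i \<in> sets M" if [measurable]: "A \<in> sets borel" for A i unfolding E_def by measurable
  have E_iff: "\<omega> \<in> E A i \<longleftrightarrow> \<omega> \<in> space M \<and> T i \<omega> < m i \<omega> \<and> S \<omega> \<in> A" for A i \<omega>
    using mpos[of \<omega> i] S_eq[of i \<omega>] by (auto simp: E_def)
  show ?law
    unfolding S_def[symmetric]
  proof (rule measure_eqI)
    fix A assume "A \<in> sets (distr M borel S)"
    then have A [measurable]: "A \<in> sets borel" by simp
    have "emeasure (distr M borel S) A = emeasure M {\<omega>\<in>space M. S \<omega> \<in> A}"
      by (subst emeasure_distr) (auto intro!: arg_cong[where f="emeasure M"])
    also have "\<dots> = emeasure M (\<Union>i. E A i)"
      using untied' by (intro emeasure_eq_AE) (auto simp: E_iff)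
    also have "\<dots> = (\<Sum>i\<in>UNIV. emeasure M (E A i))"
    proof (rule sum_emeasure[symmetric])
      show "disjoint_family_on (E A) UNIV"
        unfolding disjoint_family_on_def
      proof (intro ballI impI equals0I)
        fix i j \<omega> assume ij: "i \<noteq> j" "\<omega> \<in> E A i \<inter> E A j"
        then have "T i \<omega> < m i \<omega>" "T j \<omega> < m j \<omega>" by (auto simp: E_iff)
        moreover have "m i \<omega> \<le> T j \<omega>" "m j \<omega> \<le> T i \<omega>"
          using ij by (auto simp: m_def intro: min_others_le)
        ultimately show False by linarith
      qed
    qed auto
    also have "\<dots> = (\<Sum>i\<in>UNIV. \<integral>\<^sup>+s. f i s * indicator (A \<inter> {..<1}) s \<partial>lborel)"
    proof (intro sum.cong refl)
      fix i
      have "emeasure M (E A i) = emeasure (distr M borel (\<lambda>\<omega>. T i \<omega> / m i \<omega>)) (A \<inter> {..<1})"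
        by (subst emeasure_distr) (auto simp: E_def intro!: arg_cong[where f="emeasure M"])
      then show "emeasure M (E A i) = (\<integral>\<^sup>+s. f i s * indicator (A \<inter> {..<1}) s \<partial>lborel)"
        by (simp add: quot emeasure_density)
    qed
    also have "\<dots> = (\<integral>\<^sup>+s. (\<Sum>i\<in>UNIV. f i s * indicator (A \<inter> {..<1}) s) \<partial>lborel)"
      by (rule nn_integral_sum[symmetric]) auto
    also have "\<dots> = (\<integral>\<^sup>+s. (min_ratio_density M T k s * indicator {0<..<1} s) * indicator A s \<partial>lborel)"
      unfolding F by (intro nn_integral_cong) (auto simp: indicator_def f_neg not_less)
    also have "\<dots> = emeasure (density lborel (\<lambda>s. min_ratio_density M T k s * indicator {0<..<1} s)) A"
      using Fm by (subst emeasure_density) auto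
    finally show "emeasure (distr M borel S) A
      = emeasure (density lborel (\<lambda>s. min_ratio_density M T k s * indicator {0<..<1} s)) A" .
  qed simp
qed

section \<open>Gaussian vectors with identity covariance\<close>

lemma distr_normal_law_shift:
  "distr (normal_law m v) borel (\<lambda>x. c + x) = normal_law (c + m) v"
proof (cases "v = 0")
  case True
  then show ?thesis by (simp add: normal_law_def distr_return)
next
  case False
  show ?thesis
  proof (rule measure_eqI)
    fix A assume "A \<in> sets (distr (normal_law m v) borel (\<lambda>x. c + x))"
    then have [measurable]: "A \<in> sets borel" by simp
    have "emeasure (distr (normal_law m v) borel (\<lambda>x. c + x)) A
      = (\<integral>\<^sup>+x. ennreal (normal_density m (sqrt v) x) * indicator A (c + x) \<partial>lborel)"
      using False unfolding normal_law_def
      by (subst nn_integral_indicator[symmetric], simp, subst nn_integral_distr)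
         (auto simp: nn_integral_density)
    also have "\<dots> = (\<integral>\<^sup>+x. ennreal (normal_density m (sqrt v) (x - c)) * indicator A x \<partial>lborel)"
      by (subst nn_integral_real_affine[where c=1 and t="- c"]) auto
    also have "\<dots> = emeasure (normal_law (c + m) v) A"
      using False by (simp add: normal_law_def emeasure_density normal_density_def algebra_simps)
    finally show "emeasure (distr (normal_law m v) borel (\<lambda>x. c + x)) A = emeasure (normal_law (c + m) v) A" .
  qed (simp add: normal_law_def)
qed

text \<open>
  A linear form of the image vector is a linear form of \<open>\<xi>\<close>, up to a constant.
\<close>

lemma gaussian_vector_affine:
  fixes \<xi> :: "'a \<Rightarrow> real^'n" and X :: "real^'p^'n" and b :: "real^'p"
  assumes "gaussian_vector M \<xi> m C"
  shows "gaussian_vector M (\<lambda>\<omega>. b + transpose X *v \<xi> \<omega>) (b + transpose X *v m) (transpose X ** C ** X)"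
  unfolding gaussian_vector_def
proof (intro conjI allI)
  have xi [measurable]: "\<xi> \<in> borel_measurable M"
    and law: "\<And>a. distr M borel (\<lambda>\<omega>. a \<bullet> \<xi> \<omega>) = normal_law (a \<bullet> m) (a \<bullet> (C *v a))"
    using assms by (auto simp: gaussian_vector_def)
  have "(\<lambda>x. b + transpose X *v x) \<in> borel_measurable borel"
    by (intro borel_measurable_continuous_onI continuous_intros)
  then show "(\<lambda>\<omega>. b + transpose X *v \<xi> \<omega>) \<in> borel_measurable M"
    using xi by (rule measurable_compose_rev)
  fix a :: "real^'p"
  have adj: "a \<bullet> (transpose X *v y) = (X *v a) \<bullet> y" for y
    by (metis dot_lmul_matrix transpose_matrix_vector transpose_transpose)
  have "distr M borel (\<lambda>\<omega>. a \<bullet> (b + transpose X *v \<xi> \<omega>)) =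
    distr (distr M borel (\<lambda>\<omega>. (X *v a) \<bullet> \<xi> \<omega>)) borel (\<lambda>x. a \<bullet> b + x)"
    by (subst distr_distr) (auto simp: inner_add_right adj o_def simp del: transpose_matrix_vector)
  also have "\<dots> = normal_law (a \<bullet> b + (X *v a) \<bullet> m) ((X *v a) \<bullet> (C *v (X *v a)))"
    by (simp add: law distr_normal_law_shift)
  also have "\<dots> = normal_law (a \<bullet> (b + transpose X *v m)) (a \<bullet> ((transpose X ** C ** X) *v a))"
    by (simp add: inner_add_right adj matrix_vector_mul_assoc[symmetric] del: transpose_matrix_vector)
  finally show "distr M borel (\<lambda>\<omega>. a \<bullet> (b + transpose X *v \<xi> \<omega>))
    = normal_law (a \<bullet> (b + transpose X *v m)) (a \<bullet> ((transpose X ** C ** X) *v a))" .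
qed

lemma char_normal_law:
  assumes "0 \<le> v"
  shows "char (normal_law m v) t = iexp (t * m) * exp (- (v * t\<^sup>2) / 2)"
proof (cases "v = 0")
  case True
  have "(CLINT x|return borel m. iexp (t * x)) = iexp (t * m)"
    by (rule integral_return) auto
  with True show ?thesis by (simp add: normal_law_def char_def)
next
  case False
  define \<sigma> where "\<sigma> = sqrt v"
  have \<sigma>: "\<sigma> > 0" "\<sigma>\<^sup>2 = v" using False assms by (auto simp: \<sigma>_def)
  \<comment> \<open>The law is the image of the standard normal one under \<open>x \<mapsto> m + \<sigma> x\<close>.\<close>
  have "distributed std_normal_distribution lborel (\<lambda>x. x) (\<lambda>x. ennreal (std_normal_density x))"
    by (auto simp: distributed_def distr_id2)
  then have "distributed std_normal_distribution lborel (\<lambda>x. m + \<sigma> * x) (normal_density (m + \<sigma> * 0) (\<bar>\<sigma>\<bar> * 1))"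
    using \<sigma> by (intro std_normal.normal_density_affine) auto
  then have "distr std_normal_distribution borel (\<lambda>x. m + \<sigma> * x) = normal_law m v"
    using False \<sigma> by (simp add: distributed_def normal_law_def \<sigma>_def cong: distr_cong)
  then have "char (normal_law m v) t = char (distr std_normal_distribution borel (\<lambda>x. m + \<sigma> * x)) t" by simp
  also have "\<dots> = (CLINT x|std_normal_distribution. iexp (t * m) * iexp ((t * \<sigma>) * x))"
    unfolding char_def by (subst integral_distr) (auto simp: algebra_simps exp_add)
  also have "\<dots> = iexp (t * m) * char std_normal_distribution (t * \<sigma>)"
    unfolding char_def by (rule integral_mult_right_zero)
  also have "\<dots> = iexp (t * m) * exp (- (v * t\<^sup>2) / 2)"
    by (simp add: char_std_normal_distribution power_mult_distrib \<sigma>(2) mult.commute)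
  finally show ?thesis .
qed

text \<open>
  The joint characteristic function at \<open>t\<close> is the characteristic function at \<open>1\<close> of the linear form
  with coefficients \<open>t\<close>. Its exponent is a sum over coordinates, so it factorizes.
\<close>

lemma (in prob_space) gaussian_vector_identity_components:
  fixes U :: "'a \<Rightarrow> real^'p"
  assumes U: "gaussian_vector M U \<mu> (mat 1)"
  shows "indep_vars (\<lambda>_. borel) (\<lambda>i \<omega>. U \<omega> $ i) UNIV"
    and "distr M borel (\<lambda>\<omega>. U \<omega> $ i) = density lborel (\<lambda>x. ennreal (normal_density (\<mu> $ i) 1 x))"
proof -
  have [measurable]: "U \<in> borel_measurable M"
    and law: "\<And>a. distr M borel (\<lambda>\<omega>. a \<bullet> U \<omega>) = normal_law (a \<bullet> \<mu>) (a \<bullet> a)"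
    using U by (auto simp: gaussian_vector_def)
  have comp: "distr M borel (\<lambda>\<omega>. U \<omega> $ i) = normal_law (\<mu> $ i) 1" for i
    using law[of "axis i 1"] by (simp add: inner_axis' inner_axis)
  then show "distr M borel (\<lambda>\<omega>. U \<omega> $ i) = density lborel (\<lambda>x. ennreal (normal_density (\<mu> $ i) 1 x))"
    by (simp add: normal_law_def)
  have Um [measurable]: "(\<lambda>\<omega>. U \<omega> $ i) \<in> borel_measurable M" for i
    by (rule measurable_compose[OF _ borel_measurable_continuous_onI]) (auto intro!: continuous_intros)
  show "indep_vars (\<lambda>_. borel) (\<lambda>i \<omega>. U \<omega> $ i) UNIV"
  proof (rule indep_vars_if_char_factorizes)
    fix t :: "'p \<Rightarrow> real"
    define a :: "real^'p" where "a = (\<chi> i. t i)"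
    have dot: "a \<bullet> x = (\<Sum>i\<in>UNIV. t i * x $ i)" for x by (simp add: a_def inner_vec_def)
    have aa: "a \<bullet> a = (\<Sum>i\<in>UNIV. (t i)\<^sup>2)" by (simp add: dot) (simp add: a_def power2_eq_square)
    have "(CLINT \<omega>|M. (\<Prod>i\<in>UNIV. iexp (t i * U \<omega> $ i))) = (CLINT \<omega>|M. iexp (1 * (a \<bullet> U \<omega>)))"
      by (simp add: dot exp_sum[symmetric] sum_distrib_left)
    also have "\<dots> = char (distr M borel (\<lambda>\<omega>. a \<bullet> U \<omega>)) 1"
      unfolding char_def by (subst integral_distr) auto
    also have "\<dots> = iexp (a \<bullet> \<mu>) * exp (- (a \<bullet> a) / 2)"
      by (simp add: law char_normal_law)
    also have "\<dots> = (\<Prod>i\<in>UNIV. iexp (t i * \<mu> $ i) * of_real (exp (- (t i)\<^sup>2 / 2)))"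
      unfolding prod.distrib of_real_prod[symmetric] aa
      by (simp add: dot exp_sum[symmetric] sum_distrib_left sum_negf sum_divide_distrib)
    also have "\<dots> = (\<Prod>i\<in>UNIV. char (distr M borel (\<lambda>\<omega>. U \<omega> $ i)) (t i))"
      by (simp add: comp char_normal_law)
    finally show "(CLINT \<omega>|M. (\<Prod>i\<in>UNIV. iexp (t i * U \<omega> $ i)))
      = (\<Prod>i\<in>UNIV. char (distr M borel (\<lambda>\<omega>. U \<omega> $ i)) (t i))" .
  qed auto
qed

text \<open>
  Applied to the sum and the difference of two coordinates, this excludes ties between their moduli.
\<close>

lemma gaussian_vector_identity_linear_form_nonzero:
  fixes U :: "'a \<Rightarrow> real^'p"
  assumes U: "gaussian_vector M U \<mu> (mat 1)" and a: "a \<noteq> 0"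
  shows "AE \<omega> in M. a \<bullet> U \<omega> \<noteq> 0"
proof -
  have [measurable]: "U \<in> borel_measurable M"
    and law: "distr M borel (\<lambda>\<omega>. a \<bullet> U \<omega>) = normal_law (a \<bullet> \<mu>) (a \<bullet> a)"
    using U by (auto simp: gaussian_vector_def)
  have "AE x in lborel. 0 < normal_density (a \<bullet> \<mu>) (sqrt (a \<bullet> a)) x \<longrightarrow> x \<noteq> 0"
    using AE_lborel_singleton[of "0::real"] by eventually_elim simp
  then have "AE x in distr M borel (\<lambda>\<omega>. a \<bullet> U \<omega>). x \<noteq> 0"
    unfolding law normal_law_def using a by (simp add: AE_density)
  then show ?thesis by (simp add: AE_distr_iff)
qed

section \<open>The spacing statistic as a ratio of tail probabilities\<close>

lemma max_pair_maximizes: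
  fixes U :: "real^'p"
  assumes "max_pair U = (i, \<epsilon>)"
  shows "\<epsilon> \<in> {1, -1}" "\<epsilon> * U $ i = infnorm U" "\<bar>U $ i\<bar> = infnorm U"
proof -
  have "infnorm U = Max (range (\<lambda>i. \<bar>U $ i\<bar>))"
    unfolding infnorm_cart setcompr_eq_image Collect_mem_eq by (rule cSup_eq_Max) auto
  also have "\<dots> \<in> range (\<lambda>i. \<bar>U $ i\<bar>)" by (rule Max_in) auto
  finally obtain j where j: "\<bar>U $ j\<bar> = infnorm U" by auto
  have "\<exists>p. case p of (i, \<epsilon>) \<Rightarrow> \<epsilon> \<in> {1, -1} \<and> \<epsilon> * U $ i = infnorm U"
    by (rule exI[of _ "(j, if U $ j \<ge> 0 then 1 else -1)"]) (use j in auto)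
  then have "case max_pair U of (i, \<epsilon>) \<Rightarrow> \<epsilon> \<in> {1, -1} \<and> \<epsilon> * U $ i = infnorm U"
    unfolding max_pair_def by (rule someI_ex)
  then show "\<epsilon> \<in> {1, -1}" and *: "\<epsilon> * U $ i = infnorm U"
    by (auto simp: assms)
  then show "\<bar>U $ i\<bar> = infnorm U" using infnorm_pos_le[of U] by auto
qed

text \<open>
  Whichever maximizing pair is chosen, its index minimizes the tail probabilities, and with vanishing
  off-diagonal covariances \<open>lambda2\<close> is the largest of the remaining moduli.
\<close>

lemma spacing_ratio_eq_min_ratio:
  fixes U :: "real^'p"
  assumes card: "CARD('p) \<ge> 2"
  shows "std_normal_tail (lambda1 U) / std_normal_tail (lambda2 (mat 1) U)
    = min_ratio (\<lambda>j. std_normal_tail \<bar>U $ j\<bar>)"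
proof -
  obtain i \<epsilon> where mp: "max_pair U = (i, \<epsilon>)" by fastforce
  note spec = max_pair_maximizes[OF mp]
  have l1: "lambda1 U = \<bar>U $ i\<bar>" using spec by (simp add: lambda1_def mp)
  have "lambda2 (mat 1) U = (MAX j \<in> UNIV - {i}. \<bar>U $ j\<bar>)"
    unfolding lambda2_def mp prod.case
    by (intro arg_cong[where f=Max] image_cong refl) (auto simp: mat_def max_def)
  moreover have "std_normal_tail (MAX j \<in> UNIV - {i}. \<bar>U $ j\<bar>) = min_others (\<lambda>j. std_normal_tail \<bar>U $ j\<bar>) i"
    unfolding min_others_def
  proof (rule Min_eqI[symmetric])
    have "(MAX j \<in> UNIV - {i}. \<bar>U $ j\<bar>) \<in> (\<lambda>j. \<bar>U $ j\<bar>) ` (UNIV - {i})"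
      using others_nonempty[OF card, of i] by (intro Max_in) auto
    then show "std_normal_tail (MAX j \<in> UNIV - {i}. \<bar>U $ j\<bar>) \<in> (\<lambda>j. std_normal_tail \<bar>U $ j\<bar>) ` (UNIV - {i})"
      by auto
  qed (auto intro!: Max_ge)
  moreover have "min_ratio (\<lambda>j. std_normal_tail \<bar>U $ j\<bar>) = std_normal_tail \<bar>U $ i\<bar> / min_others (\<lambda>j. std_normal_tail \<bar>U $ j\<bar>) i"
    using component_le_infnorm_cart[of U] by (intro min_ratio_eq[OF card]) (simp add: spec(3))
  ultimately show ?thesis by (simp add: l1)
qed

section \<open>Monotonicity of the density of the ratio\<close>

lemma (in prob_space) min_ratio_density_folded_antimono:
  fixes T :: "'i::finite \<Rightarrow> 'a \<Rightarrow> real"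
  assumes card: "CARD('i) \<ge> 2" and T_pos: "\<And>i \<omega>. \<omega> \<in> space M \<Longrightarrow> 0 < T i \<omega>"
    and "0 < s" "s \<le> t"
  shows "min_ratio_density M T (\<lambda>i. folded_tail_density (\<mu> i)) t
    \<le> min_ratio_density M T (\<lambda>i. folded_tail_density (\<mu> i)) s"
  unfolding min_ratio_density_def
proof (intro nn_integral_mono ennreal_leI sum_mono)
  fix \<omega> i assume "\<omega> \<in> space M"
  then have "0 < min_others (\<lambda>j. T j \<omega>) i"
    using T_pos by (metis min_others_mem[OF card])
  then show "min_others (\<lambda>j. T j \<omega>) i * folded_tail_density (\<mu> i) (t * min_others (\<lambda>j. T j \<omega>) i)
    \<le> min_others (\<lambda>j. T j \<omega>) i * folded_tail_density (\<mu> i) (s * min_others (\<lambda>j. T j \<omega>) i)"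
    using assms by (intro mult_left_mono folded_tail_density_antimono mult_right_mono) auto
qed

text \<open>
  The integrands are strictly ordered at every sample point. Finiteness of the smaller integral is
  what carries the strict inequality over to the expectations.
\<close>

lemma (in prob_space) min_ratio_density_folded_strict_antimono:
  fixes T :: "'i::finite \<Rightarrow> 'a \<Rightarrow> real"
  assumes card: "CARD('i) \<ge> 2"
    and [measurable]: "\<And>i. T i \<in> borel_measurable M"
    and T_pos: "\<And>i \<omega>. \<omega> \<in> space M \<Longrightarrow> 0 < T i \<omega>"
    and T_le: "\<And>i \<omega>. \<omega> \<in> space M \<Longrightarrow> T i \<omega> \<le> std_normal_tail 0"
    and \<mu>: "\<mu> i \<noteq> 0" and st: "0 < s" "s < t" "t < 1"
    and fin: "min_ratio_density M T (\<lambda>i. folded_tail_density (\<mu> i)) t \<noteq> \<infinity>"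
  shows "min_ratio_density M T (\<lambda>i. folded_tail_density (\<mu> i)) t
    < min_ratio_density M T (\<lambda>i. folded_tail_density (\<mu> i)) s"
proof -
  define m where "m i \<omega> = min_others (\<lambda>j. T j \<omega>) i" for i \<omega>
  have [measurable]: "m i \<in> borel_measurable M" for i
    unfolding m_def[abs_def] by (intro min_others_measurable card) auto
  have m: "0 < m i \<omega>" "m i \<omega> \<le> std_normal_tail 0" if "\<omega> \<in> space M" for i \<omega>
    using that T_pos T_le by (metis m_def min_others_mem[OF card])+
  define g where "g s \<omega> = (\<Sum>i\<in>UNIV. m i \<omega> * folded_tail_density (\<mu> i) (s * m i \<omega>))" for s \<omega>
  have D: "min_ratio_density M T (\<lambda>i. folded_tail_density (\<mu> i)) s = (\<integral>\<^sup>+\<omega>. ennreal (g s \<omega>) \<partial>M)" for s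
    by (simp add: min_ratio_density_def g_def m_def)
  have [measurable]: "g s \<in> borel_measurable M" for s unfolding g_def[abs_def] by measurable
  have less: "g t \<omega> < g s \<omega>" if "\<omega> \<in> space M" for \<omega>
    unfolding g_def
  proof (rule sum_strict_mono_ex1)
    show "\<forall>i\<in>UNIV. m i \<omega> * folded_tail_density (\<mu> i) (t * m i \<omega>) \<le> m i \<omega> * folded_tail_density (\<mu> i) (s * m i \<omega>)"
      using m[OF that] st
      by (intro ballI mult_left_mono folded_tail_density_antimono mult_right_mono) (auto simp: less_imp_le)
    have "t * m i \<omega> < 1 * m i \<omega>"
      using m[OF that, of i] st by (intro mult_strict_right_mono) auto
    then have "t * m i \<omega> < std_normal_tail 0"
      using m[OF that, of i] by linarith
    then have "m i \<omega> * folded_tail_density (\<mu> i) (t * m i \<omega>) < m i \<omega> * folded_tail_density (\<mu> i) (s * m i \<omega>)"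
      using m[OF that, of i] st \<mu>
      by (intro mult_strict_left_mono folded_tail_density_strict_antimono) auto
    then show "\<exists>i\<in>UNIV. m i \<omega> * folded_tail_density (\<mu> i) (t * m i \<omega>) < m i \<omega> * folded_tail_density (\<mu> i) (s * m i \<omega>)"
      by blast
  qed simp
  show ?thesis
    unfolding D
  proof (rule nn_integral_less)
    show "(\<integral>\<^sup>+\<omega>. ennreal (g t \<omega>) \<partial>M) \<noteq> \<infinity>" using fin by (simp add: D)
    show "AE \<omega> in M. ennreal (g t \<omega>) \<le> ennreal (g s \<omega>)"
      using less by (intro AE_I2 ennreal_leI) (auto simp: less_imp_le)
    have g0: "0 \<le> g t \<omega>" if "\<omega> \<in> space M" for \<omega>
      unfolding g_def using m[OF that] by (intro sum_nonneg) (auto simp: less_imp_le)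
    show "\<not> (AE \<omega> in M. ennreal (g s \<omega>) \<le> ennreal (g t \<omega>))"
    proof
      assume "AE \<omega> in M. ennreal (g s \<omega>) \<le> ennreal (g t \<omega>)"
      then have "AE \<omega> in M. False"
        using AE_space
      proof eventually_elim
        case (elim \<omega>)
        then show ?case using less[of \<omega>] g0[of \<omega>] by (simp add: ennreal_le_iff)
      qed
      then show False by simp
    qed
  qed auto
qed

text \<open>
  With zero means the densities are constant on \<open>(0, \<tau>)\<close>, and \<open>s m\<^sub>i\<close> lies in this interval.
\<close>

lemma (in prob_space) min_ratio_density_folded_null:
  fixes T :: "'i::finite \<Rightarrow> 'a \<Rightarrow> real"
  assumes card: "CARD('i) \<ge> 2"
    and T_pos: "\<And>i \<omega>. \<omega> \<in> space M \<Longrightarrow> 0 < T i \<omega>"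
    and T_le: "\<And>i \<omega>. \<omega> \<in> space M \<Longrightarrow> T i \<omega> \<le> std_normal_tail 0"
    and st: "0 < s" "s < 1"
  shows "min_ratio_density M T (\<lambda>i. folded_tail_density 0) s
    = (\<integral>\<^sup>+\<omega>. ennreal (\<Sum>i\<in>UNIV. min_others (\<lambda>j. T j \<omega>) i * 2) \<partial>M)"
  unfolding min_ratio_density_def
proof (intro nn_integral_cong arg_cong[where f=ennreal] sum.cong refl)
  fix \<omega> i assume \<omega>: "\<omega> \<in> space M"
  then have m: "0 < min_others (\<lambda>j. T j \<omega>) i" "min_others (\<lambda>j. T j \<omega>) i \<le> std_normal_tail 0"
    using T_pos T_le by (metis min_others_mem[OF card])+
  have "s * min_others (\<lambda>j. T j \<omega>) i < 1 * min_others (\<lambda>j. T j \<omega>) i"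
    using m st by (intro mult_strict_right_mono) auto
  then have "s * min_others (\<lambda>j. T j \<omega>) i < std_normal_tail 0"
    using m by linarith
  then show "min_others (\<lambda>j. T j \<omega>) i * folded_tail_density 0 (s * min_others (\<lambda>j. T j \<omega>) i)
    = min_others (\<lambda>j. T j \<omega>) i * 2"
    using m st by (simp add: folded_tail_density_def)
qed

text \<open>
  The density is extended-valued by construction. It is finite on \<open>(0,1)\<close> because it is decreasing and
  has integral one. The same normalization identifies its constant value for \<open>\<mu> = 0\<close>.
\<close>

lemma (in prob_space) spacing_law:
  fixes U :: "'a \<Rightarrow> real^'p"
  assumes card: "CARD('p) \<ge> 2" and U: "gaussian_vector M U \<mu> (mat 1)"
  defines "T \<equiv> \<lambda>j \<omega>. std_normal_tail \<bar>U \<omega> $ j\<bar>"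
  defines "S \<equiv> \<lambda>\<omega>. std_normal_tail (lambda1 (U \<omega>)) / std_normal_tail (lambda2 (mat 1) (U \<omega>))"
  defines "F \<equiv> min_ratio_density M T (\<lambda>j. folded_tail_density (\<mu> $ j))"
  shows "S \<in> borel_measurable M" "F \<in> borel_measurable borel"
    and "distr M borel S = density lborel (\<lambda>s. F s * indicator {0<..<1} s)"
    and "antimono_on {0<..} F"
    and "\<And>s. s \<in> {0<..<1} \<Longrightarrow> F s \<noteq> \<infinity>"
    and "\<mu> \<noteq> 0 \<Longrightarrow> strict_antimono_on {0<..<1} F"
    and "\<And>s. \<mu> = 0 \<Longrightarrow> s \<in> {0<..<1} \<Longrightarrow> F s = 1"
proof -
  note comp = gaussian_vector_identity_components[OF U]
  have [measurable]: "(\<lambda>\<omega>. U \<omega> $ i) \<in> borel_measurable M" for i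
    using comp(1) by (auto simp: indep_vars_def)
  have Tm [measurable]: "T i \<in> borel_measurable M" for i unfolding T_def by measurable
  have T_pos: "0 < T i \<omega>" for i \<omega> by (simp add: T_def std_normal_tail_pos)
  have T_le: "T i \<omega> \<le> std_normal_tail 0" for i \<omega> by (simp add: T_def)
  have indT: "indep_vars (\<lambda>_. borel) T UNIV"
    unfolding T_def by (rule indep_vars_compose2[OF comp(1)]) simp
  have lawT: "distr M borel (T i) = density lborel (\<lambda>t. ennreal (folded_tail_density (\<mu> $ i) t))" for i
  proof -
    have "distr M borel (T i) = distr (distr M borel (\<lambda>\<omega>. U \<omega> $ i)) borel (\<lambda>x. std_normal_tail \<bar>x\<bar>)"
      by (subst distr_distr) (auto simp: T_def o_def)
    then show ?thesis by (simp add: comp(2) distr_folded_tail)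
  qed
  \<comment> \<open>Equal moduli mean that the sum or the difference of the coordinates vanishes.\<close>
  have untied: "AE \<omega> in M. T i \<omega> \<noteq> T j \<omega>" if "i \<noteq> j" for i j
  proof -
    have ne: "axis i (1::real) - axis j 1 \<noteq> (0 :: real^'p)" "axis i (1::real) + axis j 1 \<noteq> (0 :: real^'p)"
      using that by (auto simp: vec_eq_iff axis_def intro!: exI[of _ i])
    have "AE \<omega> in M. (axis i 1 - axis j 1) \<bullet> U \<omega> \<noteq> 0" "AE \<omega> in M. (axis i 1 + axis j 1) \<bullet> U \<omega> \<noteq> 0"
      using ne by (auto intro: gaussian_vector_identity_linear_form_nonzero[OF U])
    then show ?thesis
    proof eventually_elim
      case (elim \<omega>)
      then have "\<bar>U \<omega> $ i\<bar> \<noteq> \<bar>U \<omega> $ j\<bar>"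
        by (auto simp: inner_diff_left inner_add_left inner_axis' abs_eq_iff)
      then show ?case unfolding T_def by (metis std_normal_upper_quantile_tail)
    qed
  qed
  have S_eq: "S = (\<lambda>\<omega>. min_ratio (\<lambda>j. T j \<omega>))"
    unfolding S_def T_def by (simp add: spacing_ratio_eq_min_ratio[OF card])
  note law = distr_min_ratio[where k="\<lambda>j. folded_tail_density (\<mu> $ j)", OF card indT _ _ _ lawT T_pos untied,
      folded S_eq F_def]
  have k0: "folded_tail_density m t = 0" if "t \<le> 0" for m t
    using that by (simp add: folded_tail_density_def)
  show S [measurable]: "S \<in> borel_measurable M" and F [measurable]: "F \<in> borel_measurable borel"
    and dist: "distr M borel S = density lborel (\<lambda>s. F s * indicator {0<..<1} s)"
    using law k0 by auto
  show anti: "antimono_on {0<..} F"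
    unfolding F_def monotone_on_def
    using min_ratio_density_folded_antimono[OF card T_pos] by auto
  have total: "(\<integral>\<^sup>+s. F s * indicator {0<..<1} s \<partial>lborel) = 1"
  proof -
    interpret D: prob_space "distr M borel S" by (rule prob_space_distr) simp
    have "emeasure (density lborel (\<lambda>s. F s * indicator {0<..<1} s)) UNIV = 1"
      using D.emeasure_space_1 by (simp add: dist)
    then show ?thesis by (simp add: emeasure_density)
  qed
  show fin: "F s \<noteq> \<infinity>" if "s \<in> {0<..<1}" for s
  proof
    assume "F s = \<infinity>"
    \<comment> \<open>An infinite value at \<open>s\<close> would persist on \<open>(0, s]\<close>.\<close>
    have "\<infinity> = F s * emeasure lborel {0<..s}"
      using that \<open>F s = \<infinity>\<close> by (simp add: ennreal_top_mult)
    also have "\<dots> = (\<integral>\<^sup>+t. F s * indicator {0<..s} t \<partial>lborel)"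
      by (rule nn_integral_cmult_indicator[symmetric]) simp
    also have "\<dots> \<le> (\<integral>\<^sup>+t. F t * indicator {0<..<1} t \<partial>lborel)"
      using that anti by (intro nn_integral_mono) (auto simp: indicator_def monotone_on_def)
    finally show False by (simp add: total top_unique)
  qed
  show "strict_antimono_on {0<..<1} F" if "\<mu> \<noteq> 0"
  proof -
    obtain i where i: "\<mu> $ i \<noteq> 0" using \<open>\<mu> \<noteq> 0\<close> by (auto simp: vec_eq_iff)
    show ?thesis
      unfolding monotone_on_def
    proof (intro ballI impI)
      fix s t :: real assume st: "s \<in> {0<..<1}" "t \<in> {0<..<1}" "s < t"
      then show "F t < F s"
        using fin[of t] unfolding F_def
        by (intro min_ratio_density_folded_strict_antimono[where i=i] card Tm T_pos T_le i) auto
    qed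
  qed
  show "F s = 1" if \<mu>: "\<mu> = 0" and s: "s \<in> {0<..<1}" for s
  proof -
    define c where "c = (\<integral>\<^sup>+\<omega>. ennreal (\<Sum>i\<in>UNIV. min_others (\<lambda>j. T j \<omega>) i * 2) \<partial>M)"
    have F: "F s = c" if "0 < s" "s < 1" for s
      unfolding F_def c_def using min_ratio_density_folded_null[OF card T_pos T_le that] by (simp add: \<mu>)
    have "1 = (\<integral>\<^sup>+s. c * indicator {0<..<1::real} s \<partial>lborel)"
      unfolding total[symmetric] by (intro nn_integral_cong) (auto simp: indicator_def F)
    also have "\<dots> = c" by (simp add: nn_integral_cmult_indicator)
    finally show ?thesis using F s by simp
  qed
qed

section \<open>Optimality of initial intervals\<close>

text \<open>
  The Neyman-Pearson exchange argument. The part of \<open>A\<close> beyond \<open>\<alpha>\<close> is no larger than the part of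
  \<open>(0, \<alpha>]\<close> that \<open>A\<close> misses, and \<open>f \<alpha>\<close> bounds the density from above on the former and from below on
  the latter.
\<close>

lemma decreasing_density_initial_interval:
  fixes f :: "real \<Rightarrow> ennreal"
  assumes f [measurable]: "f \<in> borel_measurable borel"
    and dec: "antimono_on {0<..<1} f"
    and \<alpha>: "0 < \<alpha>" "\<alpha> < 1"
    and A [measurable]: "A \<in> sets borel"
    and size: "emeasure lborel (A \<inter> {0<..<1}) \<le> ennreal \<alpha>"
  shows "(\<integral>\<^sup>+s. f s * indicator (A \<inter> {0<..<1}) s \<partial>lborel) \<le> (\<integral>\<^sup>+s. f s * indicator {0<..\<alpha>} s \<partial>lborel)"
proof -
  let ?I = "\<lambda>B. \<integral>\<^sup>+s. f s * indicator B s \<partial>lborel"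
  have le: "f t \<le> f s" if "0 < s" "s \<le> t" "t < 1" for s t
    using dec that by (auto simp: monotone_on_def)
  have split: "?I (B \<union> C) = ?I B + ?I C" if [measurable]: "B \<in> sets borel" "C \<in> sets borel" and "B \<inter> C = {}" for B C
    using that(3) by (subst nn_integral_add[symmetric]) (auto simp: indicator_def intro!: nn_integral_cong)
  have "emeasure lborel (A \<inter> {0<..\<alpha>}) + emeasure lborel (A \<inter> {\<alpha><..<1}) = emeasure lborel (A \<inter> {0<..<1})"
    using \<alpha> by (subst plus_emeasure) (auto intro!: arg_cong[where f="emeasure lborel"])
  also have "\<dots> \<le> emeasure lborel {0<..\<alpha>}" using size \<alpha> by simp
  also have "\<dots> = emeasure lborel (A \<inter> {0<..\<alpha>}) + emeasure lborel ({0<..\<alpha>} - A)"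
    by (subst plus_emeasure) (auto intro!: arg_cong[where f="emeasure lborel"])
  finally have sz: "emeasure lborel (A \<inter> {\<alpha><..<1}) \<le> emeasure lborel ({0<..\<alpha>} - A)"
  proof -
    assume le: "emeasure lborel (A \<inter> {0<..\<alpha>}) + emeasure lborel (A \<inter> {\<alpha><..<1})
      \<le> emeasure lborel (A \<inter> {0<..\<alpha>}) + emeasure lborel ({0<..\<alpha>} - A)"
    have "emeasure lborel (A \<inter> {0<..\<alpha>}) \<le> emeasure lborel {0<..\<alpha>}"
      by (intro emeasure_mono) auto
    also have "\<dots> < \<infinity>" using \<alpha> by simp
    finally show ?thesis using le by (auto simp: ennreal_add_left_cancel_le)
  qed
  have "?I (A \<inter> {\<alpha><..<1}) \<le> (\<integral>\<^sup>+s. f \<alpha> * indicator (A \<inter> {\<alpha><..<1}) s \<partial>lborel)"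
    using \<alpha> by (intro nn_integral_mono) (auto simp: indicator_def intro!: le)
  also have "\<dots> = f \<alpha> * emeasure lborel (A \<inter> {\<alpha><..<1})"
    by (rule nn_integral_cmult_indicator) simp
  also have "\<dots> \<le> f \<alpha> * emeasure lborel ({0<..\<alpha>} - A)"
    by (intro mult_left_mono sz) simp
  also have "\<dots> = (\<integral>\<^sup>+s. f \<alpha> * indicator ({0<..\<alpha>} - A) s \<partial>lborel)"
    by (rule nn_integral_cmult_indicator[symmetric]) simp
  also have "\<dots> \<le> ?I ({0<..\<alpha>} - A)"
    using \<alpha> by (intro nn_integral_mono) (auto simp: indicator_def intro!: le)
  finally have swap: "?I (A \<inter> {\<alpha><..<1}) \<le> ?I ({0<..\<alpha>} - A)" .
  have "A \<inter> {0<..<1} = (A \<inter> {0<..\<alpha>}) \<union> (A \<inter> {\<alpha><..<1})" using \<alpha> by auto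
  then have "?I (A \<inter> {0<..<1}) = ?I (A \<inter> {0<..\<alpha>}) + ?I (A \<inter> {\<alpha><..<1})"
    by (simp only:, intro split) auto
  also have "\<dots> \<le> ?I (A \<inter> {0<..\<alpha>}) + ?I ({0<..\<alpha>} - A)"
    by (intro add_left_mono swap)
  also have "\<dots> = ?I ((A \<inter> {0<..\<alpha>}) \<union> ({0<..\<alpha>} - A))"
    by (rule split[symmetric]) auto
  also have "(A \<inter> {0<..\<alpha>}) \<union> ({0<..\<alpha>} - A) = {0<..\<alpha>}" by auto
  finally show ?thesis .
qed

theorem theorem2:
  fixes M :: "'a measure"
    and X :: "real^'p^'n"
    and \<Sigma> :: "real^'n^'n"
    and \<xi> :: "'a \<Rightarrow> real^'n"
    and S :: "real^'p \<Rightarrow> 'a \<Rightarrow> real"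
  assumes "prob_space M"
    and "CARD('p) \<ge> 2"
    and "pos_semidef \<Sigma>"
    and "gaussian_vector M \<xi> 0 \<Sigma>"
    and "score_cov X \<Sigma> = mat 1"
  defines "S \<equiv> \<lambda>\<beta> \<omega>. spacing_stat X \<Sigma> (X *v \<beta> + \<xi> \<omega>)"
  shows "(\<forall>\<beta>. X *v \<beta> \<noteq> 0 \<longrightarrow>
            (\<exists>f :: real \<Rightarrow> real.
               distributed M lborel (S \<beta>) (\<lambda>s. ennreal (f s * indicator {0<..<1} s)) \<and>
               (\<forall>s\<in>{0<..<1}. 0 \<le> f s) \<and>
               strict_antimono_on {0<..<1} f)) \<and>
         (\<forall>\<alpha>\<in>{0<..<1}. \<forall>A \<in> sets borel. A \<subseteq> {0..1} \<longrightarrow>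
            (\<forall>\<beta>. X *v \<beta> = 0 \<longrightarrow> \<P>(\<omega> in M. S \<beta> \<omega> \<in> A) \<le> \<alpha>) \<longrightarrow>
            (\<forall>\<beta>. X *v \<beta> \<noteq> 0 \<longrightarrow>
               \<P>(\<omega> in M. S \<beta> \<omega> \<in> A) \<le> \<P>(\<omega> in M. S \<beta> \<omega> \<le> \<alpha>)))"
proof -
  interpret prob_space M by fact
  define mu where "mu \<beta> = transpose X *v (X *v \<beta>)" for \<beta>
  define U where "U \<beta> \<omega> = mu \<beta> + transpose X *v \<xi> \<omega>" for \<beta> \<omega>
  have U: "gaussian_vector M (U \<beta>) (mu \<beta>) (mat 1)" for \<beta>
    using gaussian_vector_affine[OF assms(4), of "mu \<beta>" X] assms(5)
    by (simp add: U_def[abs_def] score_cov_def del: transpose_matrix_vector)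
  have S: "S \<beta> = (\<lambda>\<omega>. std_normal_tail (lambda1 (U \<beta> \<omega>)) / std_normal_tail (lambda2 (mat 1) (U \<beta> \<omega>)))" for \<beta>
    by (simp add: S_def spacing_stat_def Let_def assms(5) U_def mu_def matrix_vector_right_distrib del: transpose_matrix_vector)
  have mu_nz: "mu \<beta> \<noteq> 0" if "X *v \<beta> \<noteq> 0" for \<beta>
  proof
    assume "mu \<beta> = 0"
    then have "0 = \<beta> \<bullet> (transpose X *v (X *v \<beta>))" by (simp add: mu_def)
    also have "\<dots> = (X *v \<beta>) \<bullet> (X *v \<beta>)"
      by (metis dot_lmul_matrix transpose_matrix_vector transpose_transpose)
    finally show False using that by simp
  qed
  define F where "F \<beta> = min_ratio_density M (\<lambda>j \<omega>. std_normal_tail \<bar>U \<beta> \<omega> $ j\<bar>) (\<lambda>j. folded_tail_density (mu \<beta> $ j))" for \<beta>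
  note law = spacing_law[OF assms(2) U, folded S F_def]
  have Sm [measurable]: "S \<beta> \<in> borel_measurable M" and Fm [measurable]: "F \<beta> \<in> borel_measurable borel" for \<beta>
    by (fact law(1), fact law(2))
  have prob_S: "emeasure M {\<omega>\<in>space M. S \<beta> \<omega> \<in> B} = (\<integral>\<^sup>+s. F \<beta> s * indicator (B \<inter> {0<..<1}) s \<partial>lborel)"
    if [measurable]: "B \<in> sets borel" for \<beta> B
  proof -
    have "emeasure M {\<omega>\<in>space M. S \<beta> \<omega> \<in> B} = emeasure (distr M borel (S \<beta>)) B"
      by (subst emeasure_distr) (auto intro!: arg_cong[where f="emeasure M"])
    also have "\<dots> = (\<integral>\<^sup>+s. F \<beta> s * indicator (B \<inter> {0<..<1}) s \<partial>lborel)"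
      unfolding law(3) by (subst emeasure_density) (auto simp: indicator_def intro!: nn_integral_cong)
    finally show ?thesis .
  qed
  show ?thesis
  proof (intro conjI allI ballI impI)
    fix \<beta> assume "X *v \<beta> \<noteq> 0"
    then have strict: "strict_antimono_on {0<..<1} (F \<beta>)" by (intro law(6) mu_nz)
    define f where "f s = enn2real (F \<beta> s)" for s
    have f: "ennreal (f s) = F \<beta> s" if "s \<in> {0<..<1}" for s
      using law(5)[OF that] by (simp add: f_def less_top)
    have dens: "ennreal (f s * indicator {0<..<1} s) = F \<beta> s * indicator {0<..<1} s" for s
      by (auto simp: indicator_def f)
    show "\<exists>f :: real \<Rightarrow> real.
         distributed M lborel (S \<beta>) (\<lambda>s. ennreal (f s * indicator {0<..<1} s)) \<and>
         (\<forall>s\<in>{0<..<1}. 0 \<le> f s) \<and> strict_antimono_on {0<..<1} f"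
    proof (intro exI[of _ f] conjI ballI)
      have "distr M lborel (S \<beta>) = distr M borel (S \<beta>)" by (rule distr_cong) auto
      then show "distributed M lborel (S \<beta>) (\<lambda>s. ennreal (f s * indicator {0<..<1} s))"
        unfolding distributed_def dens by (auto simp: law(3))
      show "0 \<le> f s" for s by (simp add: f_def)
      show "strict_antimono_on {0<..<1} f"
        unfolding monotone_on_def
      proof (intro ballI impI)
        fix s t :: real assume st: "s \<in> {0<..<1}" "t \<in> {0<..<1}" "s < t"
        then have "ennreal (f t) < ennreal (f s)"
          using strict by (simp add: f monotone_on_def)
        then show "f t < f s" by (simp add: f_def ennreal_less_iff)
      qed
    qed
  next
    fix \<alpha> A \<beta>
    assume \<alpha>: "\<alpha> \<in> {0<..<1::real}" and A [measurable]: "A \<in> sets borel" and "A \<subseteq> {0..1}"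
      and null: "\<forall>\<beta>. X *v \<beta> = 0 \<longrightarrow> \<P>(\<omega> in M. S \<beta> \<omega> \<in> A) \<le> \<alpha>"
    \<comment> \<open>For the zero parameter the density is one, so the level is a Lebesgue measure.\<close>
    have "emeasure lborel (A \<inter> {0<..<1}) = (\<integral>\<^sup>+s. F 0 s * indicator (A \<inter> {0<..<1}) s \<partial>lborel)"
      by (subst nn_integral_indicator[symmetric], simp, intro nn_integral_cong)
         (auto simp: indicator_def law(7) mu_def)
    also have "\<dots> = emeasure M {\<omega>\<in>space M. S 0 \<omega> \<in> A}"
      by (rule prob_S[symmetric]) simp
    also have "\<dots> \<le> ennreal \<alpha>"
      using null[rule_format, of 0] \<alpha> by (simp add: emeasure_eq_measure ennreal_leI)
    finally have size: "emeasure lborel (A \<inter> {0<..<1}) \<le> ennreal \<alpha>" .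
    have "emeasure M {\<omega>\<in>space M. S \<beta> \<omega> \<in> A} = (\<integral>\<^sup>+s. F \<beta> s * indicator (A \<inter> {0<..<1}) s \<partial>lborel)"
      by (rule prob_S) simp
    also have "\<dots> \<le> (\<integral>\<^sup>+s. F \<beta> s * indicator {0<..\<alpha>} s \<partial>lborel)"
      using \<alpha> size law(4)[of \<beta>]
      by (intro decreasing_density_initial_interval) (auto intro: monotone_on_subset)
    also have "\<dots> = (\<integral>\<^sup>+s. F \<beta> s * indicator ({..\<alpha>} \<inter> {0<..<1}) s \<partial>lborel)"
      using \<alpha> by (intro nn_integral_cong) (auto simp: indicator_def)
    also have "\<dots> = emeasure M {\<omega>\<in>space M. S \<beta> \<omega> \<in> {..\<alpha>}}"
      by (rule prob_S[symmetric]) simp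
    finally show "\<P>(\<omega> in M. S \<beta> \<omega> \<in> A) \<le> \<P>(\<omega> in M. S \<beta> \<omega> \<le> \<alpha>)"
      by (simp add: emeasure_eq_measure)
  qed
qed

end
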